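(* Let $T>0$, $I=[0,T]$, $a\in L^\alpha(I)$ real-valued with $\alpha\ge 1$, and suppose that the periodic problem $u''(t)+a(t)u(t)=0$ a.e. on $I$, $u(0)=u(T)$, $u'(0)=u'(T)$ has only the trivial solution. Assume that $\lambda_A<0$ and that $f$ satisfies the following hypotheses (with $G_P$, $v_P$, $\gamma$ as defined in the context). (i) $f\colon I\times[0,\infty)\to[0,\infty)$ is $L^1$-Carathéodory: $f(\cdot,x)$ is measurable for every $x\ge 0$, $f(t,\cdot)$ is continuous for a.e. $t\in I$, and for each $r>0$ there is $\phi_r\in L^1(I)$ with $f(t,x)\le\phi_r(t)$ for all $x\in[0,r]$ and a.e. $t\in I$. (ii) There exist constants $m,M>0$ such that $m\,v_P(t)\le f(t,x)\le M\,v_P(t)$ for every $t\in I$ and $x\ge 0$, and $\frac{M}{m}\le\gamma$. (iii) There is an interval $[c,d]\subset I$ such that $\int_c^d G_P(t,s)\,dt\ge 0$ for all $s\in I$ and $\int_c^d G_P(t,s)\,dt>0$ for all $s\in[c,d]$. Then the problem $$u''(t)+a(t)\,u(t)=f(t,u(t)),\ t\in I,\qquad u(0)=u(T),\ u'(0)=u'(T),$$ has at least one positive solution in the cone $$K=\Big\{u\in\mathcal{C}(I,\mathbb{R}):\ u\ge 0\text{ on }I,\ \int_0^T u(s)\,ds\ge\sigma\|u\|\Big\},\qquad \sigma=\frac{\min_{s\in[c,d]}\int_c^d G_P(t,s)\,dt}{\max_{t,s\in I}G_P(t,s)}.$$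
   Context: $\|\cdot\|$ is the supremum norm on $\mathcal{C}(I,\mathbb{R})$. Solutions are functions $u\in W^{2,1}(I)$ satisfying the equation a.e. on $I$ together with the boundary conditions; a positive solution in $K$ means a solution $u\in K$ that is not identically zero (so $u\ge 0$ on $I$). $\lambda_P$ is the smallest eigenvalue $\lambda$ of $u''+(a(t)+\lambda)u=0$ a.e. on $I$ with periodic conditions $u(0)=u(T)$, $u'(0)=u'(T)$; $\lambda_A$ is the smallest eigenvalue of the same equation with anti-periodic conditions $u(0)=-u(T)$, $u'(0)=-u'(T)$. One has $\lambda_P<\lambda_A$. $G_P$ is the Green's function of the periodic problem: for every $h\in L^1(I)$, the unique solution $u\in W^{2,1}(I)$ of $u''+a(t)u=h(t)$ a.e. on $I$, $u(0)=u(T)$, $u'(0)=u'(T)$ is $u(t)=\int_0^T G_P(t,s)h(s)\,ds$. $G_P^+=\max\{G_P,0\}$ and $G_P^-=\max\{-G_P,0\}$ are its positive and negative parts, so $G_P=G_P^+-G_P^-$. Since $\lambda_A<0$, $G_P$ changes sign on $I\times I$. $v_P$ is a positive eigenfunction on $I$ (unique up to a positive constant factor) associated with $\lambda_P$: $v_P''+a(t)v_P=-\lambda_P v_P$ a.e. on $I$, $v_P(0)=v_P(T)$, $v_P'(0)=v_P'(T)$. $$\gamma=\inf_{t\in I}\frac{\int_0^T G_P^+(t,s)v_P(s)\,ds}{\int_0^T G_P^-(t,s)v_P(s)\,ds},$$ where the quotient is understood as $+\infty$ if the denominator vanishes. *)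

theory Defs
  imports "HOL-Analysis.Analysis"
begin

text \<open>
  Functions on the interval \<open>I = [0, T]\<close> are functions on the reals of which only the values on
  \<open>{0..T}\<close> matter; elements of Lebesgue spaces are represented by functions, not by classes.
\<close>

definition L1 :: "real \<Rightarrow> (real \<Rightarrow> real) \<Rightarrow> bool" where
  "L1 T h \<longleftrightarrow> integrable (lebesgue_on {0..T}) h"

text \<open>\<open>L\<^sup>p(I)\<close> for \<open>1 \<le> p \<le> \<infinity>\<close>.\<close>

definition Lp :: "ennreal \<Rightarrow> real \<Rightarrow> (real \<Rightarrow> real) \<Rightarrow> bool" where
  "Lp p T h \<longleftrightarrow> h \<in> borel_measurable (lebesgue_on {0..T}) \<and>
     (if p = \<infinity> then \<exists>C. AE t in lebesgue_on {0..T}. \<bar>h t\<bar> \<le> C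
      else integrable (lebesgue_on {0..T}) (\<lambda>t. \<bar>h t\<bar> powr enn2real p))"

definition abs_continuous_on :: "real \<Rightarrow> real \<Rightarrow> (real \<Rightarrow> real) \<Rightarrow> bool" where
  "abs_continuous_on a b g \<longleftrightarrow>
     (\<forall>\<epsilon>>0. \<exists>\<delta>>0. \<forall>(n::nat) x y.
        (\<forall>i<n. a \<le> x i \<and> x i \<le> y i \<and> y i \<le> b) \<and>
        (\<forall>i<n. \<forall>j<n. i \<noteq> j \<longrightarrow> {x i<..<y i} \<inter> {x j<..<y j} = {}) \<and>
        (\<Sum>i<n. y i - x i) < \<delta> \<longrightarrow>
        (\<Sum>i<n. \<bar>g (y i) - g (x i)\<bar>) < \<epsilon>)"

text \<open>
  \<open>W21 T u u' u''\<close>: the function \<open>u\<close> belongs to \<open>W\<^sup>2\<^sup>,\<^sup>1(I)\<close>, that is, it is \<open>C\<^sup>1\<close> with absolutely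
  continuous derivative, and \<open>u'\<close>, \<open>u''\<close> are its first and second derivatives. Absolute continuity
  of \<open>u'\<close> implies that \<open>u''\<close> exists almost everywhere and is integrable; the last conjunct only
  ties the variable \<open>u''\<close> to it.
\<close>

definition W21 :: "real \<Rightarrow> (real \<Rightarrow> real) \<Rightarrow> (real \<Rightarrow> real) \<Rightarrow> (real \<Rightarrow> real) \<Rightarrow> bool" where
  "W21 T u u' u'' \<longleftrightarrow>
     (\<forall>t\<in>{0..T}. (u has_real_derivative u' t) (at t within {0..T})) \<and>
     abs_continuous_on 0 T u' \<and>
     (AE t in lebesgue_on {0..T}. (u' has_real_derivative u'' t) (at t within {0..T}))"

text \<open>Solutions of \<open>u'' + q u = h\<close> a.e. on \<open>I\<close>.\<close>

definition periodic_solution ::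
    "real \<Rightarrow> (real \<Rightarrow> real) \<Rightarrow> (real \<Rightarrow> real) \<Rightarrow> (real \<Rightarrow> real) \<Rightarrow> bool" where
  "periodic_solution T q h u \<longleftrightarrow>
     (\<exists>u' u''. W21 T u u' u'' \<and>
        (AE t in lebesgue_on {0..T}. u'' t + q t * u t = h t) \<and>
        u 0 = u T \<and> u' 0 = u' T)"

definition antiperiodic_solution ::
    "real \<Rightarrow> (real \<Rightarrow> real) \<Rightarrow> (real \<Rightarrow> real) \<Rightarrow> (real \<Rightarrow> real) \<Rightarrow> bool" where
  "antiperiodic_solution T q h u \<longleftrightarrow>
     (\<exists>u' u''. W21 T u u' u'' \<and>
        (AE t in lebesgue_on {0..T}. u'' t + q t * u t = h t) \<and>
        u 0 = - u T \<and> u' 0 = - u' T)"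

definition periodic_eigenvalue :: "real \<Rightarrow> (real \<Rightarrow> real) \<Rightarrow> real \<Rightarrow> bool" where
  "periodic_eigenvalue T a l \<longleftrightarrow>
     (\<exists>u. periodic_solution T (\<lambda>t. a t + l) (\<lambda>t. 0) u \<and> (\<exists>t\<in>{0..T}. u t \<noteq> 0))"

definition antiperiodic_eigenvalue :: "real \<Rightarrow> (real \<Rightarrow> real) \<Rightarrow> real \<Rightarrow> bool" where
  "antiperiodic_eigenvalue T a l \<longleftrightarrow>
     (\<exists>u. antiperiodic_solution T (\<lambda>t. a t + l) (\<lambda>t. 0) u \<and> (\<exists>t\<in>{0..T}. u t \<noteq> 0))"

definition smallest :: "(real \<Rightarrow> bool) \<Rightarrow> real \<Rightarrow> bool" where
  "smallest P l \<longleftrightarrow> P l \<and> (\<forall>l'. P l' \<longrightarrow> l \<le> l')"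

text \<open>
  The equivalence says that the integral formula gives a periodic solution and that it is the only
  one. Continuity selects the usual representative of the kernel, which the integral formula alone
  would determine only up to null sets of \<open>s\<close>.
\<close>

definition periodic_Green ::
    "real \<Rightarrow> (real \<Rightarrow> real) \<Rightarrow> (real \<Rightarrow> real \<Rightarrow> real) \<Rightarrow> bool" where
  "periodic_Green T a G \<longleftrightarrow>
     continuous_on ({0..T} \<times> {0..T}) (\<lambda>(t, s). G t s) \<and>
     (\<forall>h. L1 T h \<longrightarrow>
        (\<forall>u. periodic_solution T a h u \<longleftrightarrow>
             (\<forall>t\<in>{0..T}. u t = (LINT s|lebesgue_on {0..T}. G t s * h s))))"

definition positive_eigenfunction ::
    "real \<Rightarrow> (real \<Rightarrow> real) \<Rightarrow> real \<Rightarrow> (real \<Rightarrow> real) \<Rightarrow> bool" where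
  "positive_eigenfunction T a l v \<longleftrightarrow>
     periodic_solution T a (\<lambda>t. - l * v t) v \<and> (\<forall>t\<in>{0..T}. 0 < v t)"

definition Green_ratio :: "real \<Rightarrow> (real \<Rightarrow> real \<Rightarrow> real) \<Rightarrow> (real \<Rightarrow> real) \<Rightarrow> ereal" where
  "Green_ratio T G v =
     (INF t\<in>{0..T}.
        let pos = (LINT s|lebesgue_on {0..T}. max (G t s) 0 * v s);
            neg = (LINT s|lebesgue_on {0..T}. max (- G t s) 0 * v s)
        in if neg = 0 then \<infinity> else ereal (pos / neg))"

definition L1_Caratheodory :: "real \<Rightarrow> (real \<Rightarrow> real \<Rightarrow> real) \<Rightarrow> bool" where
  "L1_Caratheodory T f \<longleftrightarrow>
     (\<forall>x\<ge>0. (\<lambda>t. f t x) \<in> borel_measurable (lebesgue_on {0..T})) \<and>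
     (AE t in lebesgue_on {0..T}. continuous_on {0..} (f t)) \<and>
     (\<forall>r>0. \<exists>\<phi>. L1 T \<phi> \<and> (AE t in lebesgue_on {0..T}. \<forall>x\<in>{0..r}. f t x \<le> \<phi> t))"

text \<open>For continuous \<open>G\<close> the infimum and the suprema below are attained.\<close>

definition cone_const :: "real \<Rightarrow> (real \<Rightarrow> real \<Rightarrow> real) \<Rightarrow> real \<Rightarrow> real \<Rightarrow> real" where
  "cone_const T G c d =
     (INF s\<in>{c..d}. LINT t|lebesgue_on {c..d}. G t s) /
     (SUP (t, s)\<in>{0..T} \<times> {0..T}. G t s)"

definition sup_norm :: "real \<Rightarrow> (real \<Rightarrow> real) \<Rightarrow> real" where
  "sup_norm T u = (SUP t\<in>{0..T}. \<bar>u t\<bar>)"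

definition pos_cone :: "real \<Rightarrow> real \<Rightarrow> (real \<Rightarrow> real) set" where
  "pos_cone T \<sigma> = {u. continuous_on {0..T} u \<and> (\<forall>t\<in>{0..T}. 0 \<le> u t) \<and>
     \<sigma> * sup_norm T u \<le> (LINT s|lebesgue_on {0..T}. u s)}"

end

theory Submission
  imports Defs "HOL-Complex_Analysis.Great_Picard"
begin

text \<open>
  Write \<open>u = G h\<close> for \<open>u(t) = \<integral> G(t, s) h(s) ds\<close>. Solutions are the fixed points of the operator
  \<open>L u = G (f(\<cdot>, u))\<close>. Three facts about the kernel make \<open>L\<close> have a fixed point in the cone.

  \<^emph>\<open>Positivity.\<close> If \<open>m v \<le> h \<le> M v\<close> for the positive eigenfunction \<open>v\<close>, then
  \<open>G h \<ge> m G\<^sup>+ v - M G\<^sup>- v \<ge> 0\<close>; this is what \<open>M / m \<le> \<gamma>\<close> says (\<open>Green_op_nonneg\<close>). So \<open>L\<close> maps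
  the continuous functions with values in \<open>[0, R]\<close> into themselves once \<open>R\<close> is large. The uniform bound
  \<open>f \<le> M v\<close> makes the image equicontinuous, and \<open>f\<close> being continuous in \<open>x\<close> makes \<open>L\<close> continuous,
  so Schauder's theorem applies (\<open>Hammerstein_fixed_point\<close>). Schauder's theorem is derived from Kuhn's
  combinatorial lemma, which serves cubes of every dimension at once.

  \<^emph>\<open>The cone.\<close> Let \<open>w(s) = \<integral>\<^sub>c\<^sup>d G(t, s) dt\<close>, \<open>\<eta> = min w\<close> over \<open>[c, d]\<close> and \<open>S = max G\<close>. For \<open>u = G h\<close>
  with \<open>h \<ge> 0\<close> one has \<open>\<integral>\<^sub>c\<^sup>d u = \<integral> w h\<close>, and the inequality \<open>\<eta> u(t) \<le> S \<integral>\<^sub>c\<^sup>d u\<close> follows from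
  \<open>\<eta> G(t, s) \<le> S w(s)\<close> for all \<open>t\<close> and \<open>s\<close>. For \<open>s\<close> in \<open>[c, d]\<close> the latter is trivial, but the
  integral of \<open>f\<close> also sees the complementary arc of the circle obtained by gluing \<open>0\<close> to \<open>T\<close>. There \<open>w\<close> solves the
  homogeneous equation, while \<open>y = S w - \<eta> G(t, \<cdot>)\<close> is a supersolution, nonnegative at both ends.
  If \<open>w > 0\<close>, then \<open>y / w\<close> cannot have a negative minimum inside the arc: its derivative is the Wronskian
  \<open>w y' - w' y\<close> divided by \<open>w\<^sup>2\<close>, and the Wronskian decreases along the arc
  (\<open>periodic_minimum_principle\<close>). To avoid derivatives of \<open>G\<close>, the proof replaces \<open>G(t, \<cdot>)\<close> by \<open>G k\<close>
  with \<open>k \<ge> 0\<close> integrable (\<open>Green_op_le_integral\<close>).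

  \<^emph>\<open>Positivity of \<open>w\<close>.\<close> The same principle, applied to \<open>w / v\<close>, shows that \<open>w > 0\<close> on the arc as well
  (\<open>integrated_kernel_pos\<close>), provided that \<open>\<lambda>\<^sub>P < 0\<close>. That sign is forced: \<open>v = -\<lambda>\<^sub>P G v\<close> is positive, and
  \<open>G v \<ge> 0\<close> by the positivity above (\<open>eigenvalue_neg\<close>).

  The comparison arguments integrate Wronskians of functions whose second derivatives exist only
  almost everywhere, which requires the fundamental theorem of calculus for absolutely continuous
  functions.
\<close>

(* Below, content is the Lebesgue content of a box. *)
hide_const (open) Polynomial.content

section \<open>The fundamental theorem of calculus for absolutely continuous functions\<close>

text \<open>
  Subintervals come from tagged divisions, which are sets and not enumerations, so the definition is
  needed with an arbitrary finite index set.
\<close>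

lemma abs_continuous_on_family:
  assumes "abs_continuous_on a b g" and "0 < e"
  shows "\<exists>d>0. \<forall>(S :: 'i set) u v. finite S \<and> (\<forall>i\<in>S. a \<le> u i \<and> u i \<le> v i \<and> v i \<le> b) \<and>
          (\<forall>i\<in>S. \<forall>j\<in>S. i \<noteq> j \<longrightarrow> {u i<..<v i} \<inter> {u j<..<v j} = {}) \<and>
          (\<Sum>i\<in>S. v i - u i) < d \<longrightarrow> (\<Sum>i\<in>S. \<bar>g (v i) - g (u i)\<bar>) < e"
proof -
  obtain d where "d > 0" and d: "\<forall>(n::nat) x y.
        (\<forall>i<n. a \<le> x i \<and> x i \<le> y i \<and> y i \<le> b) \<and>
        (\<forall>i<n. \<forall>j<n. i \<noteq> j \<longrightarrow> {x i<..<y i} \<inter> {x j<..<y j} = {}) \<and>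
        (\<Sum>i<n. y i - x i) < d \<longrightarrow> (\<Sum>i<n. \<bar>g (y i) - g (x i)\<bar>) < e"
    using assms(1) [unfolded abs_continuous_on_def, rule_format, OF assms(2)] by (elim exE conjE)
  show ?thesis
  proof (intro exI [of _ d] conjI \<open>d > 0\<close> allI impI, elim conjE)
    fix S :: "'i set" and u v :: "'i \<Rightarrow> real"
    assume S: "finite S" "\<forall>i\<in>S. a \<le> u i \<and> u i \<le> v i \<and> v i \<le> b"
      "\<forall>i\<in>S. \<forall>j\<in>S. i \<noteq> j \<longrightarrow> {u i<..<v i} \<inter> {u j<..<v j} = {}"
      "(\<Sum>i\<in>S. v i - u i) < d"
    obtain k where k: "bij_betw k {..<card S} S"
      using ex_bij_betw_nat_finite [OF \<open>finite S\<close>] by (auto simp: atLeast0LessThan)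
    have kS: "k i \<in> S" if "i < card S" for i
      using k that by (auto simp: bij_betw_def)
    have kinj: "k i \<noteq> k j" if "i < card S" "j < card S" "i \<noteq> j" for i j
      using k that by (auto simp: bij_betw_def inj_on_def)
    have "(\<Sum>i<card S. \<bar>g ((v \<circ> k) i) - g ((u \<circ> k) i)\<bar>) < e"
    proof (intro d [rule_format] conjI)
      show "(\<Sum>i<card S. (v \<circ> k) i - (u \<circ> k) i) < d"
        using S(4) sum.reindex_bij_betw [OF k, of "\<lambda>i. v i - u i"] by simp
      show "\<forall>i<card S. a \<le> (u \<circ> k) i \<and> (u \<circ> k) i \<le> (v \<circ> k) i \<and> (v \<circ> k) i \<le> b"
        using S(2) kS by simp
      show "\<forall>i<card S. \<forall>j<card S. i \<noteq> j \<longrightarrow> {(u \<circ> k) i<..<(v \<circ> k) i} \<inter> {(u \<circ> k) j<..<(v \<circ> k) j} = {}"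
        using S(3) kS kinj by simp
    qed
    then show "(\<Sum>i\<in>S. \<bar>g (v i) - g (u i)\<bar>) < e"
      using sum.reindex_bij_betw [OF k, of "\<lambda>i. \<bar>g (v i) - g (u i)\<bar>"] by simp
  qed
qed

text \<open>
  Choose the gauge so that two things happen. Where the derivative exists, each increment of \<open>g\<close> is close
  to the derivative times the length of the subinterval. The subintervals with tag in \<open>N\<close> have small
  total length, since the indicator of \<open>N\<close> has integral \<open>0\<close>; absolute continuity then makes their
  increments negligible.
\<close>

lemma fundamental_theorem_of_calculus_abs_continuous:
  assumes "a \<le> b" and AC: "abs_continuous_on a b g" and N: "negligible N"
    and deriv: "\<And>x. x \<in> {a..b} - N \<Longrightarrow> (g has_real_derivative g' x) (at x within {a..b})"
  shows "(g' has_integral (g b - g a)) {a..b}"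
proof -
  define h where "h = (\<lambda>x. if x \<in> N then 0 else g' x)"
  have "(h has_integral (g b - g a)) (cbox a b)"
    unfolding has_integral
  proof (intro allI impI)
    fix e :: real assume "e > 0"
    define e1 where "e1 = e / (2 * (b - a + 1))"
    have "e1 > 0" and e1: "e1 * (b - a) \<le> e / 2"
      using \<open>e > 0\<close> \<open>a \<le> b\<close> by (auto simp: e1_def field_simps)
    have "\<forall>x. \<exists>d>0. x \<in> {a..b} - N \<longrightarrow>
         (\<forall>y\<in>{a..b}. norm (y-x) < d \<longrightarrow> norm (g y - g x - g' x * (y-x)) \<le> e1 * norm (y-x))"
    proof
      fix x
      show "\<exists>d>0. x \<in> {a..b} - N \<longrightarrow>
         (\<forall>y\<in>{a..b}. norm (y-x) < d \<longrightarrow> norm (g y - g x - g' x * (y-x)) \<le> e1 * norm (y-x))"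
        using deriv[of x, unfolded has_field_derivative_def has_derivative_within_alt] \<open>e1 > 0\<close>
        by (cases "x \<in> {a..b} - N") (blast, use zero_less_one in blast)
    qed
    then obtain d where d: "\<And>x. 0 < d x"
       "\<And>x y. \<lbrakk>x \<in> {a..b} - N; y \<in> {a..b}; norm (y-x) < d x\<rbrakk>
                        \<Longrightarrow> norm (g y - g x - g' x * (y-x)) \<le> e1 * norm (y-x)"
      by metis
    obtain \<delta> where "0 < \<delta>" and \<delta>: "\<forall>(S :: (real \<times> real set) set) u v. finite S \<and>
          (\<forall>i\<in>S. a \<le> u i \<and> u i \<le> v i \<and> v i \<le> b) \<and>
          (\<forall>i\<in>S. \<forall>j\<in>S. i \<noteq> j \<longrightarrow> {u i<..<v i} \<inter> {u j<..<v j} = {}) \<and>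
          (\<Sum>i\<in>S. v i - u i) < \<delta> \<longrightarrow> (\<Sum>i\<in>S. \<bar>g (v i) - g (u i)\<bar>) < e / 2"
      using abs_continuous_on_family [OF AC half_gt_zero [OF \<open>e > 0\<close>]] by (elim exE conjE)
    have "(indicat_real N has_integral 0) (cbox a b)"
      using N by (simp add: negligible_def)
    then obtain \<gamma> where "gauge \<gamma>" and \<gamma>: "\<And>\<D>. \<D> tagged_division_of (cbox a b) \<Longrightarrow> \<gamma> fine \<D> \<Longrightarrow>
        norm ((\<Sum>(x,k)\<in>\<D>. content k *\<^sub>R indicat_real N x) - 0) < \<delta>"
      unfolding has_integral using \<open>0 < \<delta>\<close> by meson
    show "\<exists>\<gamma>. gauge \<gamma> \<and> (\<forall>\<D>. \<D> tagged_division_of (cbox a b) \<and> \<gamma> fine \<D> \<longrightarrow>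
            norm ((\<Sum>(x,k)\<in>\<D>. content k *\<^sub>R h x) - (g b - g a)) < e)"
    proof (intro exI [of _ "\<lambda>x. ball x (d x) \<inter> \<gamma> x"] conjI allI impI; (elim conjE)?)
      show "gauge (\<lambda>x. ball x (d x) \<inter> \<gamma> x)"
        using gauge_Int [OF gauge_ball_dependent \<open>gauge \<gamma>\<close>, of d] d(1) by simp
      fix p assume p: "p tagged_division_of cbox a b" and fine: "(\<lambda>x. ball x (d x) \<inter> \<gamma> x) fine p"
      define lo hi where "lo = (\<lambda>(x::real,k::real set). Inf k)" and "hi = (\<lambda>(x::real,k::real set). Sup k)"
      have fin: "finite p" using p by auto
      have interval: "snd z = {lo z..hi z} \<and> a \<le> lo z \<and> lo z \<le> hi z \<and> hi z \<le> b \<and> fst z \<in> {lo z..hi z}"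
        if "z \<in> p" for z
      proof -
        obtain x k where z: "z = (x,k)" by fastforce
        have "x \<in> k" "k \<subseteq> cbox a b" "\<exists>u v. k = cbox u v"
          using tagged_division_ofD(2-4)[OF p] that z by blast+
        then show ?thesis
          unfolding z lo_def hi_def by auto
      qed
      have disj: "{lo z<..<hi z} \<inter> {lo z'<..<hi z'} = {}" if "z \<in> p" "z' \<in> p" "z \<noteq> z'" for z z'
      proof -
        have "interior (snd z) \<inter> interior (snd z') = {}"
          using tagged_division_ofD(5)[OF p, of "fst z" "snd z" "fst z'" "snd z'"] that
          by (simp add: prod_eq_iff)
        then show ?thesis
          using interval[OF that(1)] interval[OF that(2)] by (simp only: interior_atLeastAtMost_real)
      qed
      have len: "(\<Sum>z\<in>p. hi z - lo z) = b - a" and incr: "(\<Sum>z\<in>p. g (hi z) - g (lo z)) = g b - g a"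
        using additive_tagged_division_1[where f= "\<lambda>x. x"] additive_tagged_division_1[where f= g]
            \<open>a \<le> b\<close> p by (auto simp: lo_def hi_def case_prod_unfold)
      have cont: "content (snd z) = hi z - lo z" if "z \<in> p" for z
        using interval[OF that] by simp
      define B where "B = {z \<in> p. fst z \<in> N}"
      have B: "B \<subseteq> p" "finite B" using fin by (auto simp: B_def)
      have "(\<Sum>z\<in>B. hi z - lo z) = (\<Sum>z\<in>p. content (snd z) * indicat_real N (fst z))"
        unfolding B_def sum.inter_filter [OF fin] by (intro sum.cong refl) (simp add: cont indicator_def)
      also have "\<dots> < \<delta>"
        using \<gamma>[OF p] fine by (auto simp: case_prod_unfold fine_def)
      finally have bad: "(\<Sum>z\<in>B. \<bar>g (hi z) - g (lo z)\<bar>) < e / 2"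
      proof (intro \<delta> [rule_format] conjI ballI impI)
        show "{lo z<..<hi z} \<inter> {lo z'<..<hi z'} = {}" if "z \<in> B" "z' \<in> B" "z \<noteq> z'" for z z'
          using disj [of z z'] that B(1) by blast
      qed (use interval B in \<open>simp_all only: subset_iff\<close>)
      \<comment> \<open>The increments to both sides of the tag are estimated separately and then added.\<close>
      have good: "\<bar>g (hi z) - g (lo z) - content (snd z) * h (fst z)\<bar> \<le> e1 * (hi z - lo z)" if "z \<in> p - B" for z
      proof -
        let ?x = "fst z"
        have i: "snd z = {lo z..hi z}" "a \<le> lo z" "lo z \<le> hi z" "hi z \<le> b" "lo z \<le> ?x" "?x \<le> hi z"
          using interval that by auto
        have "snd z \<subseteq> ball ?x (d ?x)"
          using fine that by (force simp: fine_def)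
        moreover have "lo z \<in> snd z" "hi z \<in> snd z"
          using i by auto
        ultimately have "lo z \<in> ball ?x (d ?x)" "hi z \<in> ball ?x (d ?x)"
          by blast+
        then have "norm (lo z - ?x) < d ?x" "norm (hi z - ?x) < d ?x"
          by (simp_all add: dist_real_def abs_minus_commute)
        moreover have "?x \<in> {a..b} - N"
          using that i by (auto simp: B_def)
        ultimately have "norm (g (lo z) - g ?x - g' ?x * (lo z - ?x)) \<le> e1 * norm (lo z - ?x)"
           "norm (g (hi z) - g ?x - g' ?x * (hi z - ?x)) \<le> e1 * norm (hi z - ?x)"
          by (intro d(2); use i in simp)+
        moreover have "norm (lo z - ?x) = ?x - lo z" "norm (hi z - ?x) = hi z - ?x"
          using i by auto
        ultimately have "\<bar>g (hi z) - g ?x - g' ?x * (hi z - ?x)\<bar> + \<bar>g (lo z) - g ?x - g' ?x * (lo z - ?x)\<bar>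
            \<le> e1 * (hi z - ?x) + e1 * (?x - lo z)"
          by (intro add_mono) simp_all
        also have "\<dots> = e1 * (hi z - lo z)"
          by (simp add: right_diff_distrib)
        finally have "\<bar>(g (hi z) - g ?x - g' ?x * (hi z - ?x)) - (g (lo z) - g ?x - g' ?x * (lo z - ?x))\<bar>
            \<le> e1 * (hi z - lo z)"
          by (rule order_trans [OF abs_triangle_ineq4])
        moreover have "(g (hi z) - g ?x - g' ?x * (hi z - ?x)) - (g (lo z) - g ?x - g' ?x * (lo z - ?x))
            = g (hi z) - g (lo z) - (hi z - lo z) * g' ?x"
          by (simp only: left_diff_distrib right_diff_distrib) simp
        moreover have "h ?x = g' ?x" "content (snd z) = hi z - lo z"
          using that cont by (auto simp: B_def h_def)
        ultimately show ?thesis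
          by simp
      qed
      have "(\<Sum>(x,k)\<in>p. content k *\<^sub>R h x) - (g b - g a)
          = - (\<Sum>z\<in>p. g (hi z) - g (lo z) - content (snd z) * h (fst z))"
        using incr by (simp add: sum_subtractf case_prod_unfold)
      also have "\<dots> = - (\<Sum>z\<in>p - B. g (hi z) - g (lo z) - content (snd z) * h (fst z)) - (\<Sum>z\<in>B. g (hi z) - g (lo z))"
        using sum.subset_diff[OF B(1) fin, of "\<lambda>z. g (hi z) - g (lo z) - content (snd z) * h (fst z)"]
        by (simp add: B_def h_def)
      finally have "norm ((\<Sum>(x,k)\<in>p. content k *\<^sub>R h x) - (g b - g a))
         \<le> \<bar>\<Sum>z\<in>p - B. g (hi z) - g (lo z) - content (snd z) * h (fst z)\<bar> + \<bar>\<Sum>z\<in>B. g (hi z) - g (lo z)\<bar>"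
        by simp
      also have "\<dots> \<le> (\<Sum>z\<in>p - B. e1 * (hi z - lo z)) + (\<Sum>z\<in>B. \<bar>g (hi z) - g (lo z)\<bar>)"
        by (intro add_mono order_trans[OF sum_abs] sum_mono good order_refl)
      also have "(\<Sum>z\<in>p - B. e1 * (hi z - lo z)) \<le> (\<Sum>z\<in>p. e1 * (hi z - lo z))"
        using fin interval \<open>e1 > 0\<close> by (intro sum_mono2) auto
      also have "\<dots> = e1 * (b - a)"
        by (simp flip: sum_distrib_left len)
      finally show "norm ((\<Sum>(x,k)\<in>p. content k *\<^sub>R h x) - (g b - g a)) < e"
        using bad e1 by linarith
    qed
  qed
  then have "(h has_integral (g b - g a)) {a..b}" by simp
  then show ?thesis
    by (rule has_integral_spike [OF N, rotated]) (auto simp: h_def)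
qed

section \<open>Absolutely continuous functions and the Wronskian\<close>

lemma abs_continuous_on_imp_continuous_on:
  assumes "abs_continuous_on a b g"
  shows "continuous_on {a..b} g"
  unfolding continuous_on_iff
proof (intro ballI allI impI)
  fix x e :: real assume x: "x \<in> {a..b}" and "0 < e"
  obtain d where "d > 0" and d: "\<forall>(n::nat) x y.
        (\<forall>i<n. a \<le> x i \<and> x i \<le> y i \<and> y i \<le> b) \<and>
        (\<forall>i<n. \<forall>j<n. i \<noteq> j \<longrightarrow> {x i<..<y i} \<inter> {x j<..<y j} = {}) \<and>
        (\<Sum>i<n. y i - x i) < d \<longrightarrow> (\<Sum>i<n. \<bar>g (y i) - g (x i)\<bar>) < e"
    using assms [unfolded abs_continuous_on_def, rule_format, OF \<open>0 < e\<close>] by (elim exE conjE)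
  have "dist (g y) (g x) < e" if "y \<in> {a..b}" "dist y x < d" for y
    using d [rule_format, of 1 "\<lambda>_. min x y" "\<lambda>_. max x y"] x that
    by (cases "x \<le> y") (auto simp: dist_real_def abs_minus_commute)
  then show "\<exists>d>0. \<forall>y\<in>{a..b}. dist y x < d \<longrightarrow> dist (g y) (g x) < e"
    using \<open>d > 0\<close> by blast
qed

lemma abs_continuous_on_subinterval:
  assumes "abs_continuous_on a b g" "a \<le> c" "d \<le> b"
  shows "abs_continuous_on c d g"
  unfolding abs_continuous_on_def
proof (intro allI impI)
  fix e :: real assume "0 < e"
  obtain \<delta> where "\<delta> > 0" and \<delta>: "\<forall>(n::nat) x y.
        (\<forall>i<n. a \<le> x i \<and> x i \<le> y i \<and> y i \<le> b) \<and>
        (\<forall>i<n. \<forall>j<n. i \<noteq> j \<longrightarrow> {x i<..<y i} \<inter> {x j<..<y j} = {}) \<and>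
        (\<Sum>i<n. y i - x i) < \<delta> \<longrightarrow> (\<Sum>i<n. \<bar>g (y i) - g (x i)\<bar>) < e"
    using assms(1) [unfolded abs_continuous_on_def, rule_format, OF \<open>0 < e\<close>] by (elim exE conjE)
  show "\<exists>\<delta>>0. \<forall>(n::nat) x y.
        (\<forall>i<n. c \<le> x i \<and> x i \<le> y i \<and> y i \<le> d) \<and>
        (\<forall>i<n. \<forall>j<n. i \<noteq> j \<longrightarrow> {x i<..<y i} \<inter> {x j<..<y j} = {}) \<and>
        (\<Sum>i<n. y i - x i) < \<delta> \<longrightarrow> (\<Sum>i<n. \<bar>g (y i) - g (x i)\<bar>) < e"
    using assms(2,3)
    by (intro exI [of _ \<delta>] conjI \<open>\<delta> > 0\<close> allI impI \<delta> [rule_format]) (auto intro: order_trans)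
qed

text \<open>
  One comparison that yields Lipschitz functions, differences and products of absolutely continuous
  functions.
\<close>

lemma abs_continuous_on_dominated:
  assumes f: "abs_continuous_on a b f" and g: "abs_continuous_on a b g" and "0 < B"
    and k: "\<And>x y. a \<le> x \<Longrightarrow> x \<le> y \<Longrightarrow> y \<le> b \<Longrightarrow>
              \<bar>k y - k x\<bar> \<le> B * (\<bar>f y - f x\<bar> + \<bar>g y - g x\<bar>)"
  shows "abs_continuous_on a b k"
  unfolding abs_continuous_on_def
proof (intro allI impI)
  fix e :: real assume "0 < e"
  then have e: "0 < e / (2 * B)" using \<open>0 < B\<close> by simp
  obtain \<delta> where "\<delta> > 0" and \<delta>: "\<forall>(n::nat) x y.
        (\<forall>i<n. a \<le> x i \<and> x i \<le> y i \<and> y i \<le> b) \<and>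
        (\<forall>i<n. \<forall>j<n. i \<noteq> j \<longrightarrow> {x i<..<y i} \<inter> {x j<..<y j} = {}) \<and>
        (\<Sum>i<n. y i - x i) < \<delta> \<longrightarrow> (\<Sum>i<n. \<bar>f (y i) - f (x i)\<bar>) < e / (2 * B)"
    using f [unfolded abs_continuous_on_def, rule_format, OF e] by (elim exE conjE)
  obtain \<delta>' where "\<delta>' > 0" and \<delta>': "\<forall>(n::nat) x y.
        (\<forall>i<n. a \<le> x i \<and> x i \<le> y i \<and> y i \<le> b) \<and>
        (\<forall>i<n. \<forall>j<n. i \<noteq> j \<longrightarrow> {x i<..<y i} \<inter> {x j<..<y j} = {}) \<and>
        (\<Sum>i<n. y i - x i) < \<delta>' \<longrightarrow> (\<Sum>i<n. \<bar>g (y i) - g (x i)\<bar>) < e / (2 * B)"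
    using g [unfolded abs_continuous_on_def, rule_format, OF e] by (elim exE conjE)
  show "\<exists>\<delta>>0. \<forall>(n::nat) x y.
        (\<forall>i<n. a \<le> x i \<and> x i \<le> y i \<and> y i \<le> b) \<and>
        (\<forall>i<n. \<forall>j<n. i \<noteq> j \<longrightarrow> {x i<..<y i} \<inter> {x j<..<y j} = {}) \<and>
        (\<Sum>i<n. y i - x i) < \<delta> \<longrightarrow> (\<Sum>i<n. \<bar>k (y i) - k (x i)\<bar>) < e"
  proof (intro exI [of _ "min \<delta> \<delta>'"] conjI allI impI, goal_cases)
    case 1 then show ?case using \<open>\<delta> > 0\<close> \<open>\<delta>' > 0\<close> by simp
  next
    case (2 n x y)
    have "(\<Sum>i<n. \<bar>k (y i) - k (x i)\<bar>) \<le> (\<Sum>i<n. B * (\<bar>f (y i) - f (x i)\<bar> + \<bar>g (y i) - g (x i)\<bar>))"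
      using 2 by (intro sum_mono k) auto
    also have "\<dots> = B * ((\<Sum>i<n. \<bar>f (y i) - f (x i)\<bar>) + (\<Sum>i<n. \<bar>g (y i) - g (x i)\<bar>))"
      by (simp only: sum_distrib_left sum.distrib distrib_left)
    also have "\<dots> < B * (e / (2 * B) + e / (2 * B))"
      using 2 \<open>0 < B\<close> by (intro mult_strict_left_mono add_strict_mono \<delta> [rule_format] \<delta>' [rule_format]) auto
    also have "\<dots> = e" using \<open>0 < B\<close> by simp
    finally show ?case .
  qed
qed

lemma abs_continuous_on_id: "abs_continuous_on a b (\<lambda>x. x)"
  unfolding abs_continuous_on_def
proof (intro allI impI, goal_cases)
  case (1 e)
  then show ?case by (intro exI [of _ e]) (auto intro!: le_less_trans [OF sum_mono])
qed

lemma bounded_image_on_interval: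
  fixes g :: "real \<Rightarrow> real"
  assumes "continuous_on {a..b} g"
  obtains B where "0 < B" "\<And>x. x \<in> {a..b} \<Longrightarrow> \<bar>g x\<bar> \<le> B"
  using compact_imp_bounded [OF compact_continuous_image [OF assms compact_Icc]]
  by (auto simp: bounded_pos)

lemma abs_continuous_on_mult:
  assumes f: "abs_continuous_on a b f" and g: "abs_continuous_on a b g"
  shows "abs_continuous_on a b (\<lambda>x. f x * g x)"
proof -
  obtain B where B: "0 < B" "\<And>x. x \<in> {a..b} \<Longrightarrow> \<bar>f x\<bar> \<le> B"
    using bounded_image_on_interval [OF abs_continuous_on_imp_continuous_on [OF f]] by blast
  obtain C where C: "0 < C" "\<And>x. x \<in> {a..b} \<Longrightarrow> \<bar>g x\<bar> \<le> C"
    using bounded_image_on_interval [OF abs_continuous_on_imp_continuous_on [OF g]] by blast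
  show ?thesis
  proof (rule abs_continuous_on_dominated [OF f g, of "B + C"])
    fix x y assume xy: "a \<le> x" "x \<le> y" "y \<le> b"
    have "\<bar>f y * g y - f x * g x\<bar> = \<bar>(f y - f x) * g y + f x * (g y - g x)\<bar>"
      by (simp add: algebra_simps)
    also have "\<dots> \<le> \<bar>f y - f x\<bar> * \<bar>g y\<bar> + \<bar>f x\<bar> * \<bar>g y - g x\<bar>"
      by (rule order_trans [OF abs_triangle_ineq]) (simp add: abs_mult)
    also have "\<dots> \<le> \<bar>f y - f x\<bar> * (B + C) + (B + C) * \<bar>g y - g x\<bar>"
      using B(1) C(1) B(2)[of x] C(2)[of y] xy by (intro add_mono mult_mono) auto
    finally show "\<bar>f y * g y - f x * g x\<bar> \<le> (B + C) * (\<bar>f y - f x\<bar> + \<bar>g y - g x\<bar>)"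
      by (simp add: algebra_simps)
  qed (use B(1) C(1) in simp)
qed

lemma abs_continuous_on_diff:
  assumes "abs_continuous_on a b f" and "abs_continuous_on a b g"
  shows "abs_continuous_on a b (\<lambda>x. f x - g x)"
proof (rule abs_continuous_on_dominated [OF assms, of 1])
  fix x y
  show "\<bar>(f y - g y) - (f x - g x)\<bar> \<le> 1 * (\<bar>f y - f x\<bar> + \<bar>g y - g x\<bar>)"
    using abs_triangle_ineq4 [of "f y - f x" "g y - g x"] by (simp add: algebra_simps)
qed simp

lemma W21_continuous:
  assumes "W21 T u u' u''"
  shows "continuous_on {0..T} u" "continuous_on {0..T} u'"
proof -
  show "continuous_on {0..T} u"
    using assms unfolding W21_def by (intro DERIV_continuous_on) blast
  show "continuous_on {0..T} u'"
    using assms unfolding W21_def by (blast intro: abs_continuous_on_imp_continuous_on)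
qed

lemma W21_abs_continuous:
  assumes "W21 T u u' u''"
  shows "abs_continuous_on 0 T u"
proof -
  obtain B where B: "0 < B" "\<And>x. x \<in> {0..T} \<Longrightarrow> \<bar>u' x\<bar> \<le> B"
    using bounded_image_on_interval [OF W21_continuous(2) [OF assms]] by blast
  show ?thesis
  proof (rule abs_continuous_on_dominated [OF abs_continuous_on_id abs_continuous_on_id B(1)])
    fix x y assume xy: "0 \<le> x" "x \<le> y" "y \<le> T"
    have "\<bar>u y - u x\<bar> \<le> B * \<bar>y - x\<bar>"
      using field_differentiable_bound [of "{0..T}" u u' B y x] assms B xy
      by (simp add: W21_def)
    also have "\<dots> \<le> B * (\<bar>y - x\<bar> + \<bar>y - x\<bar>)"
      using B(1) by (intro mult_left_mono) auto
    finally show "\<bar>u y - u x\<bar> \<le> B * (\<bar>y - x\<bar> + \<bar>y - x\<bar>)" .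
  qed
qed

lemma AE_lebesgue_on_imp_negligible:
  assumes "AE x in lebesgue_on {a..b::real}. P x"
  shows "\<exists>N. negligible N \<and> (\<forall>x\<in>{a..b} - N. P x)"
proof -
  have "AE x in lebesgue. x \<in> {a..b} \<longrightarrow> P x"
    using assms by (simp add: AE_restrict_space_iff)
  then obtain N where "N \<in> null_sets lebesgue" "{x \<in> space lebesgue. \<not> (x \<in> {a..b} \<longrightarrow> P x)} \<subseteq> N"
    unfolding eventually_ae_filter by blast
  then show ?thesis
    by (intro exI [of _ N]) (auto simp: negligible_iff_null_sets)
qed

text \<open>
  The derivative of \<open>p y' - p' y\<close> is \<open>p y'' - p'' y\<close>, in which the terms with the potential \<open>q\<close> cancel.
\<close>

lemma Wronskian_has_integral:
  assumes p: "W21 T p p' p''" "AE t in lebesgue_on {0..T}. p'' t + q t * p t = g t"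
    and y: "W21 T y y' y''" "AE t in lebesgue_on {0..T}. y'' t + q t * y t = h t"
    and st: "0 \<le> s" "s \<le> t" "t \<le> T"
  shows "((\<lambda>x. p x * h x - y x * g x) has_integral
           (p t * y' t - p' t * y t) - (p s * y' s - p' s * y s)) {s..t}"
proof -
  have AC: "abs_continuous_on s t (\<lambda>x. p x * y' x - p' x * y x)"
  proof (rule abs_continuous_on_subinterval)
    show "abs_continuous_on 0 T (\<lambda>x. p x * y' x - p' x * y x)"
      using p(1) y(1) W21_abs_continuous [OF p(1)] W21_abs_continuous [OF y(1)] unfolding W21_def
      by (intro abs_continuous_on_diff abs_continuous_on_mult) blast+
  qed (use st in auto)
  have "AE x in lebesgue_on {0..T}. (p' has_real_derivative p'' x) (at x within {0..T}) \<and>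
      (y' has_real_derivative y'' x) (at x within {0..T}) \<and>
      p'' x + q x * p x = g x \<and> y'' x + q x * y x = h x"
    using p y unfolding W21_def by auto
  then obtain N where "negligible N" and N: "\<forall>x\<in>{0..T} - N.
      (p' has_real_derivative p'' x) (at x within {0..T}) \<and>
      (y' has_real_derivative y'' x) (at x within {0..T}) \<and>
      p'' x + q x * p x = g x \<and> y'' x + q x * y x = h x"
    by (blast dest: AE_lebesgue_on_imp_negligible)
  show ?thesis
  proof (rule fundamental_theorem_of_calculus_abs_continuous [OF \<open>s \<le> t\<close> AC \<open>negligible N\<close>])
    fix x assume x: "x \<in> {s..t} - N"
    then have x': "x \<in> {0..T} - N" "{s..t} \<subseteq> {0..T}" using st by auto
    have "(p has_real_derivative p' x) (at x within {0..T})" "(y has_real_derivative y' x) (at x within {0..T})"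
      using p(1) y(1) x' by (auto simp: W21_def)
    then have "((\<lambda>x. p x * y' x - p' x * y x) has_real_derivative
        (p x * y'' x + p' x * y' x) - (p' x * y' x + p'' x * y x)) (at x within {0..T})"
      using N [rule_format, OF x'(1)] by (auto intro!: derivative_eq_intros)
    moreover have "(p x * y'' x + p' x * y' x) - (p' x * y' x + p'' x * y x) = p x * h x - y x * g x"
    proof -
      have "g x = p'' x + q x * p x" "h x = y'' x + q x * y x"
        using N [rule_format, OF x'(1)] by auto
      then show ?thesis by (simp add: algebra_simps)
    qed
    ultimately have "((\<lambda>x. p x * y' x - p' x * y x) has_real_derivative p x * h x - y x * g x) (at x within {0..T})"
      by simp
    then show "((\<lambda>x. p x * y' x - p' x * y x) has_real_derivative p x * h x - y x * g x) (at x within {s..t})"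
      by (rule DERIV_subset) (rule x'(2))
  qed
qed

section \<open>A minimum principle on an arc of the circle\<close>

text \<open>
  The arc runs from \<open>d\<close> to \<open>T = 0\<close> and on to \<open>c\<close>, and \<open>q' = r Q\<close> with \<open>r > 0\<close> and \<open>Q\<close> decreasing along it. If \<open>q\<close> is
  below \<open>\<delta>\<close> at \<open>t\<close>, it has decreased somewhere before \<open>t\<close> and increases somewhere after it. For \<open>t\<close>
  in the first piece the former makes \<open>Q\<close> negative from then on, so that \<open>q\<close> stays below \<open>\<delta>\<close> up to
  \<open>c\<close>; for \<open>t\<close> in the second piece the latter makes \<open>Q\<close> positive up to then, so that \<open>q\<close> was below \<open>\<delta>\<close>
  from \<open>d\<close> on. Both contradict the values at the ends.
\<close>

lemma arc_minimum:
  fixes q Q r :: "real \<Rightarrow> real"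
  assumes cd: "0 \<le> c" "c \<le> d" "d \<le> T"
    and deriv: "\<And>x. x \<in> {0..T} \<Longrightarrow> (q has_real_derivative Q x * r x) (at x within {0..T})"
    and r: "\<And>x. x \<in> {0..T} \<Longrightarrow> 0 < r x"
    and per: "q 0 = q T" "Q 0 = Q T"
    and decr: "\<And>x y. 0 \<le> x \<Longrightarrow> x \<le> y \<Longrightarrow> y \<le> c \<Longrightarrow> Q y \<le> Q x"
      "\<And>x y. d \<le> x \<Longrightarrow> x \<le> y \<Longrightarrow> y \<le> T \<Longrightarrow> Q y \<le> Q x"
    and ends: "\<delta> \<le> q c" "\<delta> \<le> q d"
    and t: "t \<in> {0..T} - {c..d}"
  shows "\<delta> \<le> q t"
proof (rule ccontr)
  assume "\<not> \<delta> \<le> q t"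
  then have neg: "q t < \<delta>" by simp
  have mvt: "\<exists>\<xi>. x < \<xi> \<and> \<xi> < y \<and> q y - q x = (Q \<xi> * r \<xi>) * (y - x)" if "0 \<le> x" "x < y" "y \<le> T" for x y
  proof -
    have "(q has_derivative (*) (Q z * r z)) (at z within {x..y})" if "x \<le> z" "z \<le> y" for z
      using deriv [of z] \<open>0 \<le> x\<close> \<open>y \<le> T\<close> that
      by (auto simp: has_field_derivative_def intro: has_derivative_subset)
    then show ?thesis
      using mvt_simple [OF \<open>x < y\<close>, of q "\<lambda>z. (*) (Q z * r z)"] by auto
  qed
  have down: "q y \<le> q x" if "0 \<le> x" "x \<le> y" "y \<le> T" "\<And>z. x \<le> z \<Longrightarrow> z \<le> y \<Longrightarrow> Q z \<le> 0" for x y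
  proof (cases "x = y")
    case False
    then obtain \<xi> where \<xi>: "x < \<xi>" "\<xi> < y" and "q y - q x = (Q \<xi> * r \<xi>) * (y - x)"
      using mvt [of x y] \<open>0 \<le> x\<close> \<open>x \<le> y\<close> \<open>y \<le> T\<close> by auto
    moreover have "(Q \<xi> * r \<xi>) * (y - x) \<le> 0"
      using that(4)[of \<xi>] r[of \<xi>] that(1-3) \<xi>(1,2) by (intro mult_nonpos_nonneg) auto
    ultimately show ?thesis by simp
  qed simp
  have up: "q x \<le> q y" if "0 \<le> x" "x \<le> y" "y \<le> T" "\<And>z. x \<le> z \<Longrightarrow> z \<le> y \<Longrightarrow> 0 \<le> Q z" for x y
  proof (cases "x = y")
    case False
    then obtain \<xi> where \<xi>: "x < \<xi>" "\<xi> < y" and "q y - q x = (Q \<xi> * r \<xi>) * (y - x)"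
      using mvt [of x y] \<open>0 \<le> x\<close> \<open>x \<le> y\<close> \<open>y \<le> T\<close> by auto
    moreover have "0 \<le> (Q \<xi> * r \<xi>) * (y - x)"
      using that(4)[of \<xi>] r[of \<xi>] that(1-3) \<xi>(1,2) by (intro mult_nonneg_nonneg) auto
    ultimately show ?thesis by simp
  qed simp
  have sgn: "(Q \<xi> * r \<xi>) * (y - x) < 0 \<Longrightarrow> Q \<xi> < 0" "0 < (Q \<xi> * r \<xi>) * (y - x) \<Longrightarrow> 0 < Q \<xi>"
    if "x < y" "0 \<le> \<xi>" "\<xi> \<le> T" for x y \<xi>
    using r [of \<xi>] that by (auto simp: zero_less_mult_iff mult_less_0_iff)
  consider "d < t" "t \<le> T" | "0 \<le> t" "t < c"
    using t by force
  then show False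
  proof cases
    case 1
    then obtain \<xi> where \<xi>: "d < \<xi>" "\<xi> < t" "q t - q d = (Q \<xi> * r \<xi>) * (t - d)"
      using mvt [of d t] cd by auto
    then have "Q \<xi> < 0"
      using sgn(1) [of d t \<xi>] neg ends 1 cd by auto
    then have right: "Q z < 0" if "\<xi> \<le> z" "z \<le> T" for z
      using decr(2) [of \<xi> z] that \<xi> by auto
    have left: "Q z < 0" if "0 \<le> z" "z \<le> c" for z
      using decr(1) [of 0 z] that right [of T] \<xi> 1 per by auto
    have "q c \<le> q 0"
      using left cd by (intro down) (auto intro: less_imp_le)
    also have "\<dots> = q T"
      by (rule per)
    also have "\<dots> \<le> q t"
      using right 1 cd \<xi> by (intro down) (auto intro: less_imp_le)
    finally show False
      using neg ends by simp
  next
    case 2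
    then obtain \<xi> where \<xi>: "t < \<xi>" "\<xi> < c" "q c - q t = (Q \<xi> * r \<xi>) * (c - t)"
      using mvt [of t c] cd by auto
    then have "0 < Q \<xi>"
      using sgn(2) [of t c \<xi>] neg ends 2 cd by auto
    then have left: "0 < Q z" if "0 \<le> z" "z \<le> \<xi>" for z
      using decr(1) [of z \<xi>] that \<xi> by auto
    have right: "0 < Q z" if "d \<le> z" "z \<le> T" for z
      using decr(2) [of z T] that left [of 0] \<xi> 2 per by auto
    have "q d \<le> q T"
      using right cd by (intro up) (auto intro: less_imp_le)
    also have "\<dots> = q 0"
      using per by simp
    also have "\<dots> \<le> q t"
      using left 2 cd \<xi> by (intro up) (auto intro: less_imp_le)
    finally show False
      using neg ends by simp
  qed
qed

text \<open>
  The quotient \<open>y / p\<close> has derivative \<open>Q / p\<^sup>2\<close>, where the Wronskian \<open>Q = p y' - p' y\<close> has the derivative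
  \<open>p h - y g \<le> 0\<close> off \<open>[c, d]\<close>. If \<open>g = 0\<close> and \<open>h \<le> 0\<close> there and \<open>\<delta> = 0\<close>, this says that a supersolution
  nonnegative at the ends of the arc is nonnegative on it, given a positive solution of the homogeneous
  equation.
\<close>

lemma periodic_minimum_principle:
  assumes cd: "0 \<le> c" "c \<le> d" "d \<le> T"
    and p: "periodic_solution T q g p" and pos: "\<And>t. t \<in> {0..T} \<Longrightarrow> 0 < p t"
    and y: "periodic_solution T q h y"
    and sign: "AE t in lebesgue_on {0..T}. t \<notin> {c..d} \<longrightarrow> p t * h t \<le> y t * g t"
    and ends: "\<delta> * p c \<le> y c" "\<delta> * p d \<le> y d"
    and t: "t \<in> {0..T} - {c..d}"
  shows "\<delta> * p t \<le> y t"
proof -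
  obtain p' p'' where P: "W21 T p p' p''" "AE t in lebesgue_on {0..T}. p'' t + q t * p t = g t"
      "p 0 = p T" "p' 0 = p' T"
    using p by (auto simp: periodic_solution_def)
  obtain y' y'' where Y: "W21 T y y' y''" "AE t in lebesgue_on {0..T}. y'' t + q t * y t = h t"
      "y 0 = y T" "y' 0 = y' T"
    using y by (auto simp: periodic_solution_def)
  define Q where "Q = (\<lambda>x. p x * y' x - p' x * y x)"
  obtain N where "negligible N"
    and N: "\<forall>x\<in>{0..T} - N. x \<notin> {c..d} \<longrightarrow> p x * h x \<le> y x * g x"
    using AE_lebesgue_on_imp_negligible [OF sign] by blast
  have neg: "negligible (N \<union> {c, d})"
    using \<open>negligible N\<close> by simp
  have decr: "Q v \<le> Q u" if uv: "0 \<le> u" "u \<le> v" "v \<le> T" "v \<le> c \<or> d \<le> u" for u v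
  proof -
    let ?F = "\<lambda>s. if s \<in> N \<union> {c, d} then 0 else p s * h s - y s * g s"
    have "((\<lambda>s. p s * h s - y s * g s) has_integral Q v - Q u) {u..v}"
      unfolding Q_def by (rule Wronskian_has_integral [OF P(1,2) Y(1,2) uv(1-3)])
    then have "(?F has_integral Q v - Q u) {u..v}"
      by (rule has_integral_spike [OF neg, rotated]) simp
    moreover have "?F s \<le> 0" if "s \<in> {u..v}" for s
    proof (cases "s \<in> N \<union> {c, d}")
      case False
      then have "s \<in> {0..T} - N" "s \<notin> {c..d}"
        using that uv by auto
      then show ?thesis
        using bspec [OF N, of s] by simp
    qed simp
    ultimately have "Q v - Q u \<le> 0"
      by (rule has_integral_le [OF _ has_integral_0])
    then show ?thesis by simp
  qed
  have "\<delta> \<le> y t / p t"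
  proof (rule arc_minimum [OF cd, of "\<lambda>x. y x / p x" Q "\<lambda>x. 1 / (p x)\<^sup>2"])
    fix x assume x: "x \<in> {0..T}"
    then have "(p has_real_derivative p' x) (at x within {0..T})" "(y has_real_derivative y' x) (at x within {0..T})"
      using P(1) Y(1) by (auto simp: W21_def)
    then show "((\<lambda>x. y x / p x) has_real_derivative Q x * (1 / (p x)\<^sup>2)) (at x within {0..T})"
      using pos [OF x] by (auto intro!: derivative_eq_intros simp: Q_def power2_eq_square field_simps)
  next
    show "\<delta> \<le> y c / p c" "\<delta> \<le> y d / p d"
      using ends pos [of c] pos [of d] cd by (auto simp: field_simps)
    show "0 < 1 / (p x)\<^sup>2" if "x \<in> {0..T}" for x
      using pos [OF that] by simp
    show "y 0 / p 0 = y T / p T" "Q 0 = Q T"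
      using P Y by (simp_all add: Q_def)
    show "Q v \<le> Q u" if "0 \<le> u" "u \<le> v" "v \<le> c" for u v
      using that cd by (intro decr) auto
    show "Q v \<le> Q u" if "d \<le> u" "u \<le> v" "v \<le> T" for u v
      using that cd by (intro decr) auto
  qed (rule t)
  then show ?thesis
    using pos [of t] t by (simp add: pos_le_divide_eq)
qed

section \<open>The Green operator\<close>

lemma L1_mult_continuous:
  assumes "continuous_on {0..T} u" "L1 T h"
  shows "L1 T (\<lambda>x. u x * h x)"
proof -
  obtain B where B: "0 < B" "\<And>x. x \<in> {0..T} \<Longrightarrow> \<bar>u x\<bar> \<le> B"
    using bounded_image_on_interval [OF assms(1)] by blast
  have "u \<in> borel_measurable (lebesgue_on {0..T})"
    using assms(1) by (simp add: continuous_imp_measurable_on_sets_lebesgue)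
  moreover have h: "integrable (lebesgue_on {0..T}) h"
    using assms(2) by (simp add: L1_def)
  ultimately have meas: "(\<lambda>x. u x * h x) \<in> borel_measurable (lebesgue_on {0..T})"
    using borel_measurable_times [OF _ borel_measurable_integrable [OF h]] by blast
  have "norm (u x * h x) \<le> norm (B * h x)" if "x \<in> space (lebesgue_on {0..T})" for x
    using mult_right_mono [OF B(2) [of x], of "\<bar>h x\<bar>"] that B(1) by (simp add: abs_mult)
  then have "AE x in lebesgue_on {0..T}. norm (u x * h x) \<le> norm (B * h x)"
    by (rule AE_I2)
  moreover have "integrable (lebesgue_on {0..T}) (\<lambda>x. B * h x)"
    using h by simp
  ultimately show ?thesis
    unfolding L1_def using Bochner_Integration.integrable_bound meas by blast
qed

lemma L1_continuous: "continuous_on {0..T} u \<Longrightarrow> L1 T u"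
  unfolding L1_def by (rule continuous_imp_integrable_real)

text \<open>
  The two sides differ by the increment of the Wronskian over a full period, which is zero.
\<close>

lemma Green_identity:
  assumes "0 \<le> T" and u: "periodic_solution T q h u" and z: "periodic_solution T q k z"
    and L: "L1 T h" "L1 T k"
  shows "(LINT t|lebesgue_on {0..T}. u t * k t) = (LINT t|lebesgue_on {0..T}. z t * h t)"
proof -
  obtain u' u'' where U: "W21 T u u' u''" "AE t in lebesgue_on {0..T}. u'' t + q t * u t = h t"
      "u 0 = u T" "u' 0 = u' T"
    using u by (auto simp: periodic_solution_def)
  obtain z' z'' where Z: "W21 T z z' z''" "AE t in lebesgue_on {0..T}. z'' t + q t * z t = k t"
      "z 0 = z T" "z' 0 = z' T"
    using z by (auto simp: periodic_solution_def)
  have int: "L1 T (\<lambda>t. u t * k t)" "L1 T (\<lambda>t. z t * h t)"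
    by (rule L1_mult_continuous [OF W21_continuous(1) [OF U(1)] L(2)]
        L1_mult_continuous [OF W21_continuous(1) [OF Z(1)] L(1)])+
  have "((\<lambda>t. u t * k t - z t * h t) has_integral 0) {0..T}"
    using Wronskian_has_integral [OF U(1,2) Z(1,2), of 0 T] assms(1) U(3,4) Z(3,4) by simp
  moreover have "((\<lambda>t. u t * k t - z t * h t) has_integral (LINT t|lebesgue_on {0..T}. u t * k t - z t * h t)) {0..T}"
    using int unfolding L1_def by (intro has_integral_integral_lebesgue_on) auto
  ultimately have "(LINT t|lebesgue_on {0..T}. u t * k t - z t * h t) = 0"
    by (rule has_integral_unique [THEN sym])
  then show ?thesis
    using int unfolding L1_def by simp
qed

definition Green_op :: "real \<Rightarrow> (real \<Rightarrow> real \<Rightarrow> real) \<Rightarrow> (real \<Rightarrow> real) \<Rightarrow> real \<Rightarrow> real" where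
  "Green_op T G h t = (LINT s|lebesgue_on {0..T}. G t s * h s)"

lemma periodic_Green_continuous:
  "periodic_Green T a G \<Longrightarrow> continuous_on ({0..T} \<times> {0..T}) (\<lambda>(t, s). G t s)"
  unfolding periodic_Green_def by (rule conjunct1)

lemma periodic_solution_Green_op:
  assumes "periodic_Green T a G" "L1 T h"
  shows "periodic_solution T a h (Green_op T G h)"
  using assms by (auto simp: periodic_Green_def Green_op_def)

lemma periodic_solution_imp_Green_op:
  assumes "periodic_Green T a G" "L1 T h" "periodic_solution T a h u" "t \<in> {0..T}"
  shows "u t = Green_op T G h t"
  using assms by (auto simp: periodic_Green_def Green_op_def)

lemma periodic_solution_continuous: "periodic_solution T q h u \<Longrightarrow> continuous_on {0..T} u"
  unfolding periodic_solution_def using W21_continuous(1) by blast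

lemma L1_diff: "L1 T f \<Longrightarrow> L1 T g \<Longrightarrow> L1 T (\<lambda>t. f t - g t)"
  unfolding L1_def by (rule Bochner_Integration.integrable_diff)

lemma L1_cmult: "L1 T f \<Longrightarrow> L1 T (\<lambda>t. c * f t)"
  unfolding L1_def by (rule Bochner_Integration.integrable_mult_right)

lemma L1_indicator: "L1 T (indicat_real {c..d})"
proof -
  have "indicat_real {c..d} \<in> borel_measurable (lebesgue_on {0..T})"
    by (intro measurable_restrict_space1 borel_measurable_indicator) simp
  moreover have "integrable (lebesgue_on {0..T}) (\<lambda>_. 1 :: real)"
    using L1_continuous [of T "\<lambda>_. 1"] by (simp add: L1_def)
  moreover have "AE t in lebesgue_on {0..T}. norm (indicat_real {c..d} t) \<le> norm (1 :: real)"
    by (rule AE_I2) (simp add: indicator_def)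
  ultimately show ?thesis
    unfolding L1_def using Bochner_Integration.integrable_bound by blast
qed

lemma continuous_kernel_row:
  assumes "continuous_on ({0..T} \<times> {0..T}) (\<lambda>(t, s). G t s)" "t \<in> {0..T}"
  shows "continuous_on {0..T} (\<lambda>s. G t s)" 
proof -
  have "continuous_on {0..T} (\<lambda>s. (t, s))"
    by (intro continuous_intros)
  moreover have "(\<lambda>s. (t, s)) ` {0..T} \<subseteq> {0..T} \<times> {0..T}"
    using assms(2) by auto
  ultimately show ?thesis
    using continuous_on_compose2 [OF assms(1)] by fastforce
qed

text \<open>
  Used with weights \<open>k\<close> concentrated near a point, as approximations of point evaluation.
\<close>

lemma integral_weighted_mean_close:
  assumes "L1 T (\<lambda>s. \<phi> s * k s)" "L1 T k" "\<And>s. s \<in> {0..T} \<Longrightarrow> 0 \<le> k s"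
    and "(LINT s|lebesgue_on {0..T}. k s) = 1"
    and close: "\<And>s. s \<in> {0..T} \<Longrightarrow> k s \<noteq> 0 \<Longrightarrow> \<bar>\<phi> s - C\<bar> \<le> e"
  shows "\<bar>(LINT s|lebesgue_on {0..T}. \<phi> s * k s) - C\<bar> \<le> e"
proof -
  have int: "L1 T (\<lambda>s. \<phi> s * k s - C * k s)"
    using assms by (intro L1_diff L1_cmult)
  have "(LINT s|lebesgue_on {0..T}. \<phi> s * k s) - C = (LINT s|lebesgue_on {0..T}. \<phi> s * k s - C * k s)"
    using assms by (simp add: L1_def)
  also have "\<bar>\<dots>\<bar> \<le> (LINT s|lebesgue_on {0..T}. \<bar>\<phi> s * k s - C * k s\<bar>)"
    by (rule integral_abs_bound)
  also have "\<dots> \<le> (LINT s|lebesgue_on {0..T}. e * k s)"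
  proof (rule integral_mono)
    fix s assume "s \<in> space (lebesgue_on {0..T})"
    then have "s \<in> {0..T}" by simp
    then have "\<bar>\<phi> s - C\<bar> * k s \<le> e * k s"
      using close [of s] assms(3) [of s] by (cases "k s = 0") (auto intro: mult_right_mono)
    then show "\<bar>\<phi> s * k s - C * k s\<bar> \<le> e * k s"
      using assms(3) [OF \<open>s \<in> {0..T}\<close>] by (simp add: abs_mult flip: left_diff_distrib)
  qed (use int L1_cmult [OF assms(2), of e] in \<open>auto simp: L1_def\<close>)
  also have "\<dots> = e"
    using assms by simp
  finally show ?thesis .
qed

lemma L1_bump:
  assumes "0 < T" "s0 \<in> {0..T}" "0 < r"
  shows "\<exists>k. L1 T k \<and> (\<forall>s. 0 \<le> k s) \<and> (LINT s|lebesgue_on {0..T}. k s) = 1 \<and> (\<forall>s. k s \<noteq> 0 \<longrightarrow> \<bar>s - s0\<bar> \<le> r)"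
proof -
  define c d where "c = max 0 (s0 - r)" and "d = min T (s0 + r)"
  have cd: "0 \<le> c" "c < d" "d \<le> T" "s0 - r \<le> c" "d \<le> s0 + r"
    using assms by (auto simp: c_def d_def)
  have "(LINT s|lebesgue_on {0..T}. indicat_real {c..d} s) = d - c"
    using cd by (subst Bochner_Integration.integral_indicator) (auto simp: measure_restrict_space Int_absorb2)
  then show ?thesis
    using cd L1_cmult [OF L1_indicator, of T "1 / (d - c)" c d]
    by (intro exI [of _ "\<lambda>s. 1 / (d - c) * indicat_real {c..d} s"]) (auto simp: indicator_def)
qed

text \<open>
  Green's identity says that \<open>\<integral> (G h) k = \<integral> (G k) h\<close>. For weights \<open>h\<close> and \<open>k\<close> of integral \<open>1\<close>
  concentrated near \<open>s\<close> and \<open>t\<close> the two sides are close to \<open>G(t, s)\<close> and \<open>G(s, t)\<close>.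
\<close>

lemma Green_symmetric:
  assumes "0 < T" and G: "periodic_Green T a G" and ts: "t \<in> {0..T}" "s \<in> {0..T}"
  shows "G t s = G s t"
proof -
  have cont: "continuous_on ({0..T} \<times> {0..T}) (\<lambda>(t, s). G t s)"
    by (rule periodic_Green_continuous [OF G])
  have near: "\<exists>r>0. \<forall>x\<in>{0..T}. \<forall>y\<in>{0..T}. \<bar>x - x0\<bar> \<le> r \<longrightarrow> \<bar>y - y0\<bar> \<le> r \<longrightarrow> \<bar>G x y - G x0 y0\<bar> \<le> e"
    if x0: "x0 \<in> {0..T}" "y0 \<in> {0..T}" "0 < e" for x0 y0 e
  proof -
    have mem: "(x0, y0) \<in> {0..T} \<times> {0..T}" using x0 by simp
    obtain d where "0 < d" and d: "\<forall>z\<in>{0..T} \<times> {0..T}. dist z (x0, y0) < d \<longrightarrow>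
        dist (case z of (t, s) \<Rightarrow> G t s) (case (x0, y0) of (t, s) \<Rightarrow> G t s) < e"
      using cont [unfolded continuous_on_iff, THEN bspec, OF mem, THEN spec, THEN mp, OF \<open>0 < e\<close>]
      by (elim exE conjE)
    have "\<bar>G x y - G x0 y0\<bar> \<le> e" if xy: "x \<in> {0..T}" "y \<in> {0..T}" "\<bar>x - x0\<bar> \<le> d / 3" "\<bar>y - y0\<bar> \<le> d / 3" for x y
    proof -
      have "dist (x, y) (x0, y0) \<le> \<bar>x - x0\<bar> + \<bar>y - y0\<bar>"
        unfolding dist_Pair_Pair dist_real_def
        using sqrt_sum_squares_le_sum_abs [of "x - x0" "y - y0"] by simp
      then have "dist (x, y) (x0, y0) < d"
        using xy \<open>0 < d\<close> by linarith
      then show ?thesis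
        using bspec [OF d, of "(x, y)"] xy by (simp add: dist_real_def)
    qed
    then show ?thesis
      using \<open>0 < d\<close> by (intro exI [of _ "d / 3"]) auto
  qed
  have "\<bar>G t s - G s t\<bar> \<le> 0 + e" if "0 < e" for e
  proof -
    obtain r1 where r1: "0 < r1" "\<forall>x\<in>{0..T}. \<forall>y\<in>{0..T}. \<bar>x - t\<bar> \<le> r1 \<longrightarrow> \<bar>y - s\<bar> \<le> r1 \<longrightarrow> \<bar>G x y - G t s\<bar> \<le> e / 2"
      using near [OF ts, of "e / 2"] \<open>0 < e\<close> by auto
    obtain r2 where r2: "0 < r2" "\<forall>x\<in>{0..T}. \<forall>y\<in>{0..T}. \<bar>x - s\<bar> \<le> r2 \<longrightarrow> \<bar>y - t\<bar> \<le> r2 \<longrightarrow> \<bar>G x y - G s t\<bar> \<le> e / 2"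
      using near [OF ts(2,1), of "e / 2"] \<open>0 < e\<close> by auto
    define r where "r = min r1 r2"
    have "0 < r" using r1 r2 by (simp add: r_def)
    obtain h where h: "L1 T h" "\<forall>x. 0 \<le> h x" "(LINT x|lebesgue_on {0..T}. h x) = 1" "\<forall>x. h x \<noteq> 0 \<longrightarrow> \<bar>x - s\<bar> \<le> r"
      using L1_bump [OF \<open>0 < T\<close> ts(2) \<open>0 < r\<close>] by blast
    obtain k where k: "L1 T k" "\<forall>x. 0 \<le> k x" "(LINT x|lebesgue_on {0..T}. k x) = 1" "\<forall>x. k x \<noteq> 0 \<longrightarrow> \<bar>x - t\<bar> \<le> r"
      using L1_bump [OF \<open>0 < T\<close> ts(1) \<open>0 < r\<close>] by blast
    have row: "L1 T (\<lambda>y. G x y * f y)" if "x \<in> {0..T}" "L1 T f" for x f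
      by (rule L1_mult_continuous [OF continuous_kernel_row [OF cont that(1)] that(2)])
    have op: "L1 T (\<lambda>x. Green_op T G f x * g x)" if "L1 T f" "L1 T g" for f g
      by (rule L1_mult_continuous [OF periodic_solution_continuous [OF periodic_solution_Green_op [OF G that(1)]] that(2)])
    have "\<bar>(LINT x|lebesgue_on {0..T}. Green_op T G h x * k x) - G t s\<bar> \<le> e / 2"
    proof (rule integral_weighted_mean_close [OF op [OF h(1) k(1)] k(1) _ k(3)])
      fix x assume x: "x \<in> {0..T}" "k x \<noteq> 0"
      show "\<bar>Green_op T G h x - G t s\<bar> \<le> e / 2"
        unfolding Green_op_def
      proof (rule integral_weighted_mean_close [OF row [OF x(1) h(1)] h(1) _ h(3)])
        fix y assume "y \<in> {0..T}" "h y \<noteq> 0"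
        then show "\<bar>G x y - G t s\<bar> \<le> e / 2"
          using r1(2) x h(4) k(4) by (simp add: r_def)
      qed (use h(2) in simp)
    qed (use k(2) in simp)
    moreover have "\<bar>(LINT x|lebesgue_on {0..T}. Green_op T G k x * h x) - G s t\<bar> \<le> e / 2"
    proof (rule integral_weighted_mean_close [OF op [OF k(1) h(1)] h(1) _ h(3)])
      fix x assume x: "x \<in> {0..T}" "h x \<noteq> 0"
      show "\<bar>Green_op T G k x - G s t\<bar> \<le> e / 2"
        unfolding Green_op_def
      proof (rule integral_weighted_mean_close [OF row [OF x(1) k(1)] k(1) _ k(3)])
        fix y assume "y \<in> {0..T}" "k y \<noteq> 0"
        then show "\<bar>G x y - G s t\<bar> \<le> e / 2"
          using r2(2) x h(4) k(4) by (simp add: r_def)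
      qed (use k(2) in simp)
    qed (use h(2) in simp)
    moreover have "(LINT x|lebesgue_on {0..T}. Green_op T G h x * k x) = (LINT x|lebesgue_on {0..T}. Green_op T G k x * h x)"
      using \<open>0 < T\<close> h(1) k(1)
      by (intro Green_identity [of T a] periodic_solution_Green_op [OF G]) auto
    ultimately show ?thesis by linarith
  qed
  then have "\<bar>G t s - G s t\<bar> \<le> 0"
    by (rule field_le_epsilon)
  then show ?thesis by simp
qed

lemma integral_subinterval:
  fixes \<phi> :: "real \<Rightarrow> real"
  assumes "0 \<le> c" "d \<le> T"
  shows "(LINT t|lebesgue_on {c..d}. \<phi> t) = (LINT t|lebesgue_on {0..T}. \<phi> t * indicat_real {c..d} t)"
proof -
  have "indicat_real {0..T} t *\<^sub>R (\<phi> t * indicat_real {c..d} t) = indicat_real {c..d} t *\<^sub>R \<phi> t" for t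
    using assms by (auto simp: indicator_def)
  moreover have "(LINT t|lebesgue_on {c..d}. \<phi> t) = (LINT t|lebesgue. indicat_real {c..d} t *\<^sub>R \<phi> t)"
    by (rule integral_restrict_space) simp
  moreover have "(LINT t|lebesgue_on {0..T}. \<phi> t * indicat_real {c..d} t)
      = (LINT t|lebesgue. indicat_real {0..T} t *\<^sub>R (\<phi> t * indicat_real {c..d} t))"
    by (rule integral_restrict_space) simp
  ultimately show ?thesis
    by presburger
qed

section \<open>Sign and size of Green potentials\<close>

lemma Green_op_linear:
  assumes "periodic_Green T a G" "L1 T h" "L1 T k" "t \<in> {0..T}"
  shows "Green_op T G (\<lambda>s. A * h s - B * k s) t = A * Green_op T G h t - B * Green_op T G k t"
proof -
  have "L1 T (\<lambda>s. G t s * f s)" if "L1 T f" for f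
    by (rule L1_mult_continuous [OF continuous_kernel_row [OF periodic_Green_continuous [OF assms(1)] assms(4)] that])
  then have "L1 T (\<lambda>s. G t s * h s)" "L1 T (\<lambda>s. G t s * k s)"
    using assms by auto
  then have "(LINT s|lebesgue_on {0..T}. A * (G t s * h s) - B * (G t s * k s)) = A * Green_op T G h t - B * Green_op T G k t"
    by (simp add: L1_def Green_op_def)
  then show ?thesis
    by (simp add: Green_op_def algebra_simps)
qed

text \<open>
  By symmetry \<open>w(s) = \<integral>\<^sub>c\<^sup>d G(t, s) dt\<close> solves \<open>w'' + a w = \<chi>\<close>, where \<open>\<chi>\<close> is the indicator of \<open>[c, d]\<close>.
\<close>

lemma integrated_kernel_eq_Green_op:
  assumes "0 < T" "periodic_Green T a G" "0 \<le> c" "d \<le> T" "s \<in> {0..T}"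
  shows "(LINT t|lebesgue_on {c..d}. G t s) = Green_op T G (indicat_real {c..d}) s"
proof -
  have "(LINT t|lebesgue_on {0..T}. G t s * indicat_real {c..d} t) = (LINT t|lebesgue_on {0..T}. G s t * indicat_real {c..d} t)"
    using Green_symmetric [OF assms(1,2)] assms(5)
    by (intro Bochner_Integration.integral_cong refl) simp
  then show ?thesis
    using assms by (simp add: integral_subinterval [of c d T] Green_op_def)
qed

text \<open>
  Off \<open>[c, d]\<close> the Wronskian of \<open>v\<close> and \<open>w\<close> has derivative \<open>l v w \<le> 0\<close>, so \<open>w / v\<close> is at least the smaller
  of its values at \<open>c\<close> and \<open>d\<close>.
\<close>

lemma integrated_kernel_pos:
  assumes cd: "0 < T" "0 \<le> c" "c \<le> d" "d \<le> T" and G: "periodic_Green T a G"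
    and v: "positive_eigenfunction T a l v" and "l \<le> 0"
    and nonneg: "\<And>s. s \<in> {0..T} \<Longrightarrow> 0 \<le> Green_op T G (indicat_real {c..d}) s"
    and pos: "\<And>s. s \<in> {c..d} \<Longrightarrow> 0 < Green_op T G (indicat_real {c..d}) s"
    and s: "s \<in> {0..T}"
  shows "0 < Green_op T G (indicat_real {c..d}) s"
proof (cases "s \<in> {c..d}")
  case True
  then show ?thesis by (rule pos)
next
  case False
  let ?w = "Green_op T G (indicat_real {c..d})"
  have v0: "0 < v t" if "t \<in> {0..T}" for t
    using v that by (simp add: positive_eigenfunction_def)
  define \<delta> where "\<delta> = min (?w c / v c) (?w d / v d)"
  have "0 < \<delta>"
    using pos [of c] pos [of d] v0 [of c] v0 [of d] cd by (simp add: \<delta>_def)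
  have "\<delta> * v s \<le> ?w s"
  proof (rule periodic_minimum_principle [of c d T a "\<lambda>t. - l * v t" v "indicat_real {c..d}" ?w])
    show "periodic_solution T a (\<lambda>t. - l * v t) v"
      using v by (simp add: positive_eigenfunction_def)
    show "periodic_solution T a (indicat_real {c..d}) ?w"
      by (rule periodic_solution_Green_op [OF G L1_indicator])
    show "AE t in lebesgue_on {0..T}. t \<notin> {c..d} \<longrightarrow> v t * indicat_real {c..d} t \<le> ?w t * (- l * v t)"
    proof (rule AE_I2, rule impI)
      fix t assume t: "t \<in> space (lebesgue_on {0..T})" "t \<notin> {c..d}"
      have "0 \<le> ?w t * (- l * v t)"
        using nonneg [of t] v0 [of t] t(1) \<open>l \<le> 0\<close> by (intro mult_nonneg_nonneg) auto
      then show "v t * indicat_real {c..d} t \<le> ?w t * (- l * v t)"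
        using t(2) by simp
    qed
    have "\<delta> \<le> ?w c / v c" "\<delta> \<le> ?w d / v d"
      by (simp_all add: \<delta>_def)
    then show "\<delta> * v c \<le> ?w c" "\<delta> * v d \<le> ?w d"
      using v0 [of c] v0 [of d] cd by (simp_all add: pos_le_divide_eq)
  qed (use cd False s v0 in auto)
  moreover have "0 < \<delta> * v s"
    using \<open>0 < \<delta>\<close> v0 [OF s] by simp
  ultimately show ?thesis by linarith
qed

text \<open>
  Pointwise this is \<open>\<eta> G(t, s) \<le> S w(s)\<close> integrated against \<open>h\<close>. It is proved in a weak form: for \<open>k \<ge> 0\<close>
  the function \<open>y = S (\<integral> k) w - \<eta> G k\<close> is nonnegative by the minimum principle with \<open>p = w\<close>, and testing \<open>y\<close>
  against \<open>h\<close> bounds \<open>\<eta> \<integral> u k\<close> by \<open>S (\<integral> k) (\<integral>\<^sub>c\<^sup>d u)\<close>, where \<open>u = G h\<close>. As \<open>k\<close> is arbitrary, this is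
  a pointwise bound for \<open>u\<close>.
\<close>

lemma Green_op_le_integral:
  assumes cd: "0 < T" "0 \<le> c" "c \<le> d" "d \<le> T" and G: "periodic_Green T a G"
    and wpos: "\<And>s. s \<in> {0..T} \<Longrightarrow> 0 < Green_op T G (indicat_real {c..d}) s"
    and \<eta>: "0 \<le> \<eta>" "\<And>s. s \<in> {c..d} \<Longrightarrow> \<eta> \<le> Green_op T G (indicat_real {c..d}) s"
    and S: "0 \<le> S" "\<And>t s. t \<in> {0..T} \<Longrightarrow> s \<in> {0..T} \<Longrightarrow> G t s \<le> S"
    and h: "L1 T h" "\<And>s. s \<in> {0..T} \<Longrightarrow> 0 \<le> h s"
    and t: "t \<in> {0..T}"
  shows "\<eta> * Green_op T G h t \<le> S * (LINT t|lebesgue_on {c..d}. Green_op T G h t)"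
proof -
  let ?\<chi> = "indicat_real {c..d}"
  define w where "w = Green_op T G ?\<chi>"
  define u where "u = Green_op T G h"
  define C where "C = (LINT t|lebesgue_on {0..T}. u t * ?\<chi> t)"
  note sol = periodic_solution_Green_op [OF G]
  have cont: "continuous_on {0..T} (Green_op T G f)" if "L1 T f" for f
    by (rule periodic_solution_continuous [OF sol [OF that]])
  have weak: "\<eta> * (LINT s|lebesgue_on {0..T}. u s * k s) \<le> S * (LINT s|lebesgue_on {0..T}. k s) * C"
    if k: "L1 T k" "\<And>s. s \<in> {0..T} \<Longrightarrow> 0 \<le> k s" for k
  proof -
    define \<kappa> where "\<kappa> = (LINT s|lebesgue_on {0..T}. k s)"
    define z where "z = Green_op T G k"
    define g where "g = (\<lambda>s. (S * \<kappa>) * ?\<chi> s - \<eta> * k s)"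
    have "L1 T g"
      unfolding g_def by (intro L1_diff L1_cmult L1_indicator k)
    have "0 \<le> \<kappa>"
      unfolding \<kappa>_def using k(2) by (intro integral_nonneg_AE AE_I2) simp
    have y: "Green_op T G g s = (S * \<kappa>) * w s - \<eta> * z s" if "s \<in> {0..T}" for s
      unfolding g_def w_def z_def by (rule Green_op_linear [OF G L1_indicator k(1) that])
    have on_arc: "0 \<le> Green_op T G g s" if "s \<in> {c..d}" for s
    proof -
      have s: "s \<in> {0..T}" using that cd by auto
      have "L1 T (\<lambda>r. G s r * k r)"
        by (rule L1_mult_continuous [OF continuous_kernel_row [OF periodic_Green_continuous [OF G] s] k(1)])
      then have "z s \<le> (LINT r|lebesgue_on {0..T}. S * k r)"
        unfolding z_def Green_op_def using k L1_cmult [OF k(1), of S] S(2) [OF s]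
        by (intro integral_mono) (auto simp: L1_def intro: mult_right_mono)
      also have "\<dots> = S * \<kappa>"
        by (simp add: \<kappa>_def)
      finally have "\<eta> * z s \<le> \<eta> * (S * \<kappa>)"
        using \<eta>(1) by (rule mult_left_mono)
      also have "\<dots> \<le> (S * \<kappa>) * w s"
        using mult_left_mono [OF \<eta>(2) [OF that], of "S * \<kappa>"] S(1) \<open>0 \<le> \<kappa>\<close> by (simp add: w_def mult.commute)
      finally show ?thesis
        using y [OF s] by simp
    qed
    have y_nonneg: "0 \<le> Green_op T G g s" if s: "s \<in> {0..T}" for s
    proof (cases "s \<in> {c..d}")
      case False
      have "0 * w s \<le> Green_op T G g s"
      proof (rule periodic_minimum_principle [of c d T a ?\<chi> w g])
        show "periodic_solution T a ?\<chi> w"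
          unfolding w_def by (rule sol [OF L1_indicator])
        show "periodic_solution T a g (Green_op T G g)"
          by (rule sol [OF \<open>L1 T g\<close>])
        show "AE t in lebesgue_on {0..T}. t \<notin> {c..d} \<longrightarrow> w t * g t \<le> Green_op T G g t * ?\<chi> t"
        proof (rule AE_I2, rule impI)
          fix t assume t: "t \<in> space (lebesgue_on {0..T})" "t \<notin> {c..d}"
          then have "0 \<le> w t * (\<eta> * k t)"
            using wpos [of t] \<eta>(1) k(2) [of t] by (simp add: w_def)
          then show "w t * g t \<le> Green_op T G g t * ?\<chi> t"
            using t(2) by (simp add: g_def)
        qed
      qed (use cd s False wpos on_arc in \<open>auto simp: w_def\<close>)
      then show ?thesis by simp
    qed (rule on_arc)
    have "0 \<le> (LINT s|lebesgue_on {0..T}. Green_op T G g s * h s)"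
      using y_nonneg h(2) by (intro integral_nonneg_AE AE_I2) simp
    also have "\<dots> = (LINT s|lebesgue_on {0..T}. u s * g s)"
      unfolding u_def using cd by (intro Green_identity [OF _ sol sol] h \<open>L1 T g\<close>) auto
    also have "\<dots> = (LINT s|lebesgue_on {0..T}. (S * \<kappa>) * (u s * ?\<chi> s) - \<eta> * (u s * k s))"
      by (simp add: g_def algebra_simps)
    also have "\<dots> = S * \<kappa> * C - \<eta> * (LINT s|lebesgue_on {0..T}. u s * k s)"
      using L1_mult_continuous [OF cont [OF h(1)] k(1)] L1_mult_continuous [OF cont [OF h(1)] L1_indicator, of c d]
      by (simp add: L1_def C_def u_def)
    finally show ?thesis
      by (simp add: \<kappa>_def)
  qed
  \<comment> \<open>The excess of \<open>\<eta> u\<close> over the claimed bound is its own test function.\<close>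
  define k where "k = (\<lambda>s. max 0 (\<eta> * u s - S * C))"
  have u_cont: "continuous_on {0..T} u"
    unfolding u_def by (rule cont [OF h(1)])
  have k_cont: "continuous_on {0..T} k"
    unfolding k_def by (intro continuous_intros u_cont)
  have k2: "L1 T (\<lambda>s. k s * k s)"
    by (intro L1_continuous continuous_intros k_cont)
  have "(LINT s|lebesgue_on {0..T}. k s * k s) = (LINT s|lebesgue_on {0..T}. \<eta> * (u s * k s) - (S * C) * k s)"
    by (intro Bochner_Integration.integral_cong refl) (simp add: k_def max_def algebra_simps)
  also have "\<dots> = \<eta> * (LINT s|lebesgue_on {0..T}. u s * k s) - (S * C) * (LINT s|lebesgue_on {0..T}. k s)"
    using L1_continuous [OF k_cont] L1_mult_continuous [OF u_cont L1_continuous [OF k_cont]]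
    by (simp add: L1_def)
  also have "\<dots> \<le> 0"
    using weak [OF L1_continuous [OF k_cont]] by (simp add: k_def mult.commute mult.left_commute)
  finally have "(LINT s|lebesgue_on {0..T}. k s * k s) \<le> 0" .
  moreover have "(LINT s|lebesgue_on {0..T}. k s * k s) = integral {0..T} (\<lambda>s. k s * k s)"
    using k2 by (simp add: L1_def lebesgue_integral_eq_integral)
  moreover have "0 \<le> integral {0..T} (\<lambda>s. k s * k s)"
    by (intro integral_nonneg integrable_continuous_real continuous_intros k_cont) simp
  ultimately have "integral {0..T} (\<lambda>s. k s * k s) = 0"
    by linarith
  then have "\<forall>s\<in>{0..T}. k s * k s = 0"
    using integral_eq_0_iff [of 0 T "\<lambda>s. k s * k s"] \<open>0 < T\<close> k_cont by (simp add: continuous_on_mult)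
  then have "k t = 0"
    using t by simp
  then have "\<eta> * u t \<le> S * C"
    by (simp add: k_def max_def split: if_splits)
  then show ?thesis
    using cd integral_subinterval [of c d T u] by (simp add: u_def C_def)
qed

text \<open>
  Bounding \<open>h\<close> below by \<open>m v\<close> where \<open>G \<ge> 0\<close> and above by \<open>M v\<close> where \<open>G < 0\<close> gives
  \<open>G h \<ge> m P - M N\<close>, where \<open>P / N\<close> is the quotient whose infimum is the ratio.
\<close>

lemma Green_op_nonneg:
  assumes G: "continuous_on ({0..T} \<times> {0..T}) (\<lambda>(t, s). G t s)"
    and v: "continuous_on {0..T} v" "\<And>s. s \<in> {0..T} \<Longrightarrow> 0 < v s"
    and ratio: "ereal (M / m) \<le> Green_ratio T G v" and "0 < m"
    and h: "L1 T h" "\<And>s. s \<in> {0..T} \<Longrightarrow> m * v s \<le> h s \<and> h s \<le> M * v s"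
    and t: "t \<in> {0..T}"
  shows "0 \<le> Green_op T G h t"
proof -
  define P where "P = (LINT s|lebesgue_on {0..T}. max (G t s) 0 * v s)"
  define N where "N = (LINT s|lebesgue_on {0..T}. max (- G t s) 0 * v s)"
  have row: "continuous_on {0..T} (\<lambda>s. G t s)"
    by (rule continuous_kernel_row [OF G t])
  have int: "L1 T (\<lambda>s. max (G t s) 0 * v s)" "L1 T (\<lambda>s. max (- G t s) 0 * v s)"
    by (intro L1_continuous continuous_intros row v)+
  have "0 \<le> P" "0 \<le> N"
    unfolding P_def N_def using v(2) by (intro integral_nonneg_AE AE_I2; force intro: less_imp_le)+
  have "M * N \<le> m * P"
  proof (cases "N = 0")
    case True
    then show ?thesis using \<open>0 < m\<close> \<open>0 \<le> P\<close> by simp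
  next
    case False
    have "Green_ratio T G v \<le> ereal (P / N)"
      unfolding Green_ratio_def using False t
      by (intro INF_lower2 [OF t]) (simp add: Let_def P_def N_def)
    then have "ereal (M / m) \<le> ereal (P / N)"
      using ratio by (rule order_trans [rotated])
    then show ?thesis
      using False \<open>0 \<le> N\<close> \<open>0 < m\<close> by (simp add: field_simps)
  qed
  then have "0 \<le> m * P - M * N" by simp
  also have "\<dots> = (LINT s|lebesgue_on {0..T}. m * (max (G t s) 0 * v s) - M * (max (- G t s) 0 * v s))"
    using int by (simp add: L1_def P_def N_def)
  also have "\<dots> \<le> (LINT s|lebesgue_on {0..T}. G t s * h s)"
  proof (rule integral_mono)
    fix s assume "s \<in> space (lebesgue_on {0..T})"
    then have "m * v s \<le> h s" "h s \<le> M * v s"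
      using h(2) by auto
    then show "m * (max (G t s) 0 * v s) - M * (max (- G t s) 0 * v s) \<le> G t s * h s"
      using mult_left_mono [of "m * v s" "h s" "G t s"] mult_left_mono [of "h s" "M * v s" "- G t s"]
      by (cases "0 \<le> G t s") (simp_all add: max_def algebra_simps)
  next
    show "integrable (lebesgue_on {0..T}) (\<lambda>s. G t s * h s)"
      using L1_mult_continuous [OF row h(1)] by (simp add: L1_def)
    show "integrable (lebesgue_on {0..T}) (\<lambda>s. m * (max (G t s) 0 * v s) - M * (max (- G t s) 0 * v s))"
      using int by (simp add: L1_def)
  qed
  finally show ?thesis
    by (simp add: Green_op_def)
qed

text \<open>
  Since \<open>v\<close> solves the equation with right-hand side \<open>- l v\<close>, it satisfies \<open>v = - l G v\<close>.
\<close>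

lemma eigenvalue_neg:
  assumes "0 \<le> T" and G: "periodic_Green T a G" and v: "positive_eigenfunction T a l v"
    and nonneg: "0 \<le> Green_op T G v 0"
  shows "l < 0" and "0 < Green_op T G v 0"
proof -
  have sol: "periodic_solution T a (\<lambda>t. - l * v t) v" and "0 < v 0"
    using v \<open>0 \<le> T\<close> by (auto simp: positive_eigenfunction_def)
  have L1v: "L1 T v"
    by (rule L1_continuous [OF periodic_solution_continuous [OF sol]])
  have "v 0 = Green_op T G (\<lambda>t. - l * v t) 0"
    using \<open>0 \<le> T\<close> by (intro periodic_solution_imp_Green_op [OF G L1_cmult [OF L1v] sol]) simp
  also have "\<dots> = - l * Green_op T G v 0"
    using Green_op_linear [OF G L1v L1v, of 0 "- l" 0] \<open>0 \<le> T\<close> by simp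
  finally have "0 < - l * Green_op T G v 0"
    using \<open>0 < v 0\<close> by simp
  then show "l < 0" "0 < Green_op T G v 0"
    using nonneg by (auto simp: zero_less_mult_iff mult_less_0_iff)
qed

section \<open>Schauder's fixed point theorem for continuous functions\<close>

text \<open>
  An approximate form of Brouwer's theorem, with the dimension \<open>n\<close> a variable. Vectors are functions of
  which only the values below \<open>n\<close> matter. Label coordinate \<open>i\<close> of a grid point \<open>x\<close> by \<open>0\<close> if \<open>F\<close> does not
  decrease it and by \<open>1\<close> if \<open>F\<close> does not increase it. In the cell provided by Kuhn's lemma every
  coordinate carries both labels, hence is nearly fixed.
\<close>

lemma approximate_fixed_point_in_cube:
  fixes F :: "(nat \<Rightarrow> real) \<Rightarrow> nat \<Rightarrow> real"
  assumes "0 < R" "0 < e" "0 < \<delta>"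
    and range: "\<And>x i. (\<And>j. j < n \<Longrightarrow> x j \<in> {0..R}) \<Longrightarrow> i < n \<Longrightarrow> F x i \<in> {0..R}"
    and cont: "\<And>x y i. (\<And>j. j < n \<Longrightarrow> x j \<in> {0..R}) \<Longrightarrow> (\<And>j. j < n \<Longrightarrow> y j \<in> {0..R}) \<Longrightarrow>
            (\<And>j. j < n \<Longrightarrow> \<bar>x j - y j\<bar> \<le> \<delta>) \<Longrightarrow> i < n \<Longrightarrow> \<bar>F x i - F y i\<bar> \<le> e"
  shows "\<exists>x. (\<forall>j<n. x j \<in> {0..R}) \<and> (\<forall>i<n. \<bar>F x i - x i\<bar> \<le> 2 * e)"
proof -
  obtain p :: nat where "0 < p" and p: "R / p \<le> min \<delta> e"
  proof -
    obtain p :: nat where p: "R / min \<delta> e < p" using reals_Archimedean2 by blast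
    have "0 < R / min \<delta> e" using assms by simp
    then have "0 < real p" using p by linarith
    moreover have "R < real p * min \<delta> e"
      using p assms(2,3) by (simp only: pos_divide_less_eq min_less_iff_conj)
    ultimately have "R / p \<le> min \<delta> e"
      by (simp only: pos_divide_le_eq mult.commute less_imp_le)
    then show thesis
      using that [of p] \<open>0 < real p\<close> by simp
  qed
  define grid where "grid = (\<lambda>(x :: nat \<Rightarrow> nat) j. R * x j / p)"
  \<comment> \<open>On the faces of the cube the label is dictated by the lemma, and correct because \<open>F\<close> maps into the cube.\<close>
  define label where "label = (\<lambda>x i. if x i = 0 \<or> (x i < p \<and> grid x i \<le> F (grid x) i) then 0 else 1 :: nat)"
  have grid: "grid x j \<in> {0..R}" if "x j \<le> p" for x j
    using that \<open>0 < R\<close> \<open>0 < p\<close> by (auto simp: grid_def field_simps)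
  have label0: "grid x i \<le> F (grid x) i" if "label x i = 0" "\<And>j. j < n \<Longrightarrow> x j \<le> p" "i < n" for x i
    using that range [of "grid x" i] grid [of x] by (auto simp: label_def grid_def split: if_splits)
  have label1: "F (grid x) i \<le> grid x i" if "label x i \<noteq> 0" "\<And>j. j < n \<Longrightarrow> x j \<le> p" "i < n" for x i
    using that range [of "grid x" i] grid [of x] \<open>0 < p\<close> le_antisym [of "x i" p]
    by (fastforce simp: label_def grid_def not_less split: if_splits)
  obtain q where q: "\<forall>i<n. q i < p"
    and cell: "\<forall>i<n. \<exists>r s. (\<forall>j<n. q j \<le> r j \<and> r j \<le> q j + 1) \<and>
          (\<forall>j<n. q j \<le> s j \<and> s j \<le> q j + 1) \<and> label r i \<noteq> label s i"
  proof (rule kuhn_lemma [OF \<open>0 < p\<close>, of n label])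
  qed (use \<open>0 < p\<close> in \<open>auto simp: label_def\<close>)
  have "\<bar>F (grid q) i - grid q i\<bar> \<le> 2 * e" if "i < n" for i
  proof -
    have near: "\<bar>F (grid r) i - F (grid q) i\<bar> \<le> e \<and> grid q i \<le> grid r i \<and> grid r i \<le> grid q i + e
         \<and> (\<forall>j<n. r j \<le> p)"
      if r: "\<forall>j<n. q j \<le> r j \<and> r j \<le> q j + 1" for r
    proof -
      have rp: "r j \<le> p" if "j < n" for j using r q that by force
      have step: "grid q j \<le> grid r j \<and> grid r j \<le> grid q j + R / p" if "j < n" for j
      proof -
        have "real (q j) \<le> r j" "real (r j) \<le> q j + 1" using r that by force+
        then have "R * q j \<le> R * r j" "R * r j \<le> R * q j + R"
          using \<open>0 < R\<close> mult_left_mono [of "real (r j)" "q j + 1" R] by (auto simp: algebra_simps)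
        then show ?thesis
          using \<open>0 < p\<close> by (auto simp: grid_def divide_right_mono simp flip: add_divide_distrib)
      qed
      have "\<bar>F (grid r) i - F (grid q) i\<bar> \<le> e"
      proof (rule cont)
        show "\<bar>grid r j - grid q j\<bar> \<le> \<delta>" if "j < n" for j
          using step [OF that] p by linarith
      qed (use grid rp q \<open>i < n\<close> in \<open>auto intro: less_imp_le\<close>)
      then show ?thesis
        using step [OF \<open>i < n\<close>] p rp by auto
    qed
    obtain r s where rs: "\<forall>j<n. q j \<le> r j \<and> r j \<le> q j + 1" "\<forall>j<n. q j \<le> s j \<and> s j \<le> q j + 1"
        "label r i = 0" "label s i \<noteq> 0"
    proof -
      obtain r s where "\<forall>j<n. q j \<le> r j \<and> r j \<le> q j + 1" "\<forall>j<n. q j \<le> s j \<and> s j \<le> q j + 1"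
        "label r i \<noteq> label s i"
        using cell \<open>i < n\<close> by blast
      moreover have "label z i = 0 \<or> label z i = 1" for z
        by (simp add: label_def)
      ultimately show thesis
        using that [of r s] that [of s r] by (metis zero_neq_one)
    qed
    show ?thesis
      using near [OF rs(1)] near [OF rs(2)] label0 [OF rs(3)] label1 [OF rs(4)] \<open>i < n\<close> by auto
  qed
  moreover have "\<forall>j<n. grid q j \<in> {0..R}"
    using grid q by (auto intro: less_imp_le)
  ultimately show ?thesis by blast
qed

text \<open>
  A closed convex set in the space of continuous functions on \<open>K\<close>; values outside \<open>K\<close> are irrelevant.
\<close>

definition continuous_band :: "'a::metric_space set \<Rightarrow> real \<Rightarrow> ('a \<Rightarrow> real) set" where
  "continuous_band K R = {u. continuous_on K u \<and> (\<forall>t\<in>K. u t \<in> {0..R})}"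

text \<open>
  The functions are the normalised bumps \<open>max 0 (\<eta> - dist (a i) t)\<close> around the points of a net.
\<close>

lemma partition_of_unity_near_finite_net:
  fixes K :: "'a::metric_space set"
  assumes "compact K" "0 < \<eta>"
  obtains n a \<phi> where "\<And>i. i < (n::nat) \<Longrightarrow> a i \<in> K" "\<And>i. i < n \<Longrightarrow> continuous_on K (\<phi> i)"
    "\<And>i t. i < n \<Longrightarrow> t \<in> K \<Longrightarrow> (0::real) \<le> \<phi> i t" "\<And>t. t \<in> K \<Longrightarrow> (\<Sum>i<n. \<phi> i t) = 1"
    "\<And>i t. i < n \<Longrightarrow> t \<in> K \<Longrightarrow> \<phi> i t \<noteq> 0 \<Longrightarrow> dist (a i) t < \<eta>"
proof -
  obtain N where N: "finite N" "N \<subseteq> K" "K \<subseteq> (\<Union>x\<in>N. ball x \<eta>)"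
  proof (rule compactE_image [OF \<open>compact K\<close>, of K "\<lambda>x. ball x \<eta>"])
    show "K \<subseteq> (\<Union>x\<in>K. ball x \<eta>)" using \<open>0 < \<eta>\<close> by auto
  qed auto
  obtain n and a :: "nat \<Rightarrow> 'a" where a: "N = a ` {i. i < n}"
    using finite_imp_nat_seg_image_inj_on [OF \<open>finite N\<close>] by blast
  define \<psi> where "\<psi> = (\<lambda>i t. max 0 (\<eta> - dist (a i) t))"
  have pos: "0 < (\<Sum>i<n. \<psi> i t)" if "t \<in> K" for t
  proof -
    have "t \<in> (\<Union>x\<in>N. ball x \<eta>)" using N(3) that by blast
    then obtain i where "i < n" "dist (a i) t < \<eta>"
      using a by auto
    then show ?thesis
      by (intro sum_pos2 [of _ i]) (auto simp: \<psi>_def)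
  qed
  show thesis
  proof (rule that [of n a "\<lambda>i t. \<psi> i t / (\<Sum>i<n. \<psi> i t)"])
    show "continuous_on K (\<lambda>t. \<psi> i t / (\<Sum>i<n. \<psi> i t))" if "i < n" for i
    proof (intro continuous_on_divide ballI)
      show "continuous_on K (\<psi> i)" "continuous_on K (\<lambda>t. \<Sum>i<n. \<psi> i t)"
        unfolding \<psi>_def by (intro continuous_intros)+
      show "(\<Sum>i<n. \<psi> i t) \<noteq> 0" if "t \<in> K" for t
        using pos [OF that] by simp
    qed
    show "(\<Sum>i<n. \<psi> i t / (\<Sum>i<n. \<psi> i t)) = 1" if "t \<in> K" for t
      using pos [OF that] by (simp flip: sum_divide_distrib)
    show "0 \<le> \<psi> i t / (\<Sum>i<n. \<psi> i t)" if "t \<in> K" for i t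
      using pos [OF that] by (simp add: \<psi>_def)
    show "dist (a i) t < \<eta>" if "\<psi> i t / (\<Sum>i<n. \<psi> i t) \<noteq> 0" for i t
      using that by (auto simp: \<psi>_def max_def split: if_splits)
    show "a i \<in> K" if "i < n" for i
      using N(2) a that by auto
  qed
qed

text \<open>
  By equicontinuity, \<open>L u\<close> is determined up to \<open>e / 2\<close> by its values at the points of a fine net. The
  approximate Brouwer theorem is applied to the map that interpolates a vector of such values
  by the partition of unity, applies \<open>L\<close> and reads off the values at the net.
\<close>

lemma Schauder_approximate_fixed_point:
  fixes K :: "'a::metric_space set" and L :: "('a \<Rightarrow> real) \<Rightarrow> 'a \<Rightarrow> real"
  assumes "compact K" "0 < R"
    and into: "\<And>u. u \<in> continuous_band K R \<Longrightarrow> L u \<in> continuous_band K R"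
    and equicont: "\<And>e. 0 < e \<Longrightarrow> \<exists>d>0. \<forall>u\<in>continuous_band K R. \<forall>s\<in>K. \<forall>t\<in>K. dist s t < d \<longrightarrow> \<bar>L u s - L u t\<bar> < e"
    and cont: "\<And>e. 0 < e \<Longrightarrow> \<exists>d>0. \<forall>u\<in>continuous_band K R. \<forall>w\<in>continuous_band K R.
            (\<forall>t\<in>K. \<bar>u t - w t\<bar> \<le> d) \<longrightarrow> (\<forall>t\<in>K. \<bar>L u t - L w t\<bar> \<le> e)"
    and "0 < e"
  shows "\<exists>u\<in>continuous_band K R. \<forall>t\<in>K. \<bar>L u t - u t\<bar> \<le> e"
proof -
  obtain \<eta> where "0 < \<eta>" and \<eta>: "\<forall>u\<in>continuous_band K R. \<forall>s\<in>K. \<forall>t\<in>K. dist s t < \<eta> \<longrightarrow> \<bar>L u s - L u t\<bar> < e / 2"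
    using equicont [of "e / 2"] \<open>0 < e\<close> by auto
  obtain \<delta> where "0 < \<delta>" and \<delta>: "\<forall>u\<in>continuous_band K R. \<forall>w\<in>continuous_band K R.
            (\<forall>t\<in>K. \<bar>u t - w t\<bar> \<le> \<delta>) \<longrightarrow> (\<forall>t\<in>K. \<bar>L u t - L w t\<bar> \<le> e / 4)"
    using cont [of "e / 4"] \<open>0 < e\<close> by auto
  obtain n a \<phi> where a: "\<And>i. i < (n::nat) \<Longrightarrow> a i \<in> K" and \<phi>_cont: "\<And>i. i < n \<Longrightarrow> continuous_on K (\<phi> i)"
    and \<phi>_nonneg: "\<And>i t. i < n \<Longrightarrow> t \<in> K \<Longrightarrow> (0::real) \<le> \<phi> i t" and \<phi>_sum: "\<And>t. t \<in> K \<Longrightarrow> (\<Sum>i<n. \<phi> i t) = 1"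
    and \<phi>_supp: "\<And>i t. i < n \<Longrightarrow> t \<in> K \<Longrightarrow> \<phi> i t \<noteq> 0 \<Longrightarrow> dist (a i) t < \<eta>"
    using partition_of_unity_near_finite_net [OF \<open>compact K\<close> \<open>0 < \<eta>\<close>] by blast
  define U where "U = (\<lambda>x t. \<Sum>i<n. x i * \<phi> i t)"
  have average: "\<bar>\<Sum>i<n. y i * \<phi> i t\<bar> \<le> C" if "t \<in> K" "\<And>i. i < n \<Longrightarrow> \<phi> i t \<noteq> 0 \<Longrightarrow> \<bar>y i\<bar> \<le> C" for y t C
  proof -
    have "\<bar>\<Sum>i<n. y i * \<phi> i t\<bar> \<le> (\<Sum>i<n. C * \<phi> i t)"
    proof (rule order_trans [OF sum_abs sum_mono])
      fix i assume "i \<in> {..<n}"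
      then show "\<bar>y i * \<phi> i t\<bar> \<le> C * \<phi> i t"
        using that(2) [of i] \<phi>_nonneg [of i t] \<open>t \<in> K\<close>
        by (cases "\<phi> i t = 0") (auto simp: abs_mult intro: mult_right_mono)
    qed
    also have "\<dots> = C"
      using \<phi>_sum [OF \<open>t \<in> K\<close>] by (simp flip: sum_distrib_left)
    finally show ?thesis .
  qed
  have U: "U x \<in> continuous_band K R" if x: "\<And>j. j < n \<Longrightarrow> x j \<in> {0..R}" for x
    unfolding continuous_band_def
  proof (intro CollectI conjI ballI)
    show "continuous_on K (U x)"
      unfolding U_def by (intro continuous_intros \<phi>_cont) auto
    fix t assume "t \<in> K"
    then have "0 \<le> U x t"
      unfolding U_def using x \<phi>_nonneg by (intro sum_nonneg mult_nonneg_nonneg) auto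
    moreover have "\<bar>U x t\<bar> \<le> R"
      unfolding U_def using x by (intro average \<open>t \<in> K\<close>) auto
    ultimately show "U x t \<in> {0..R}" by auto
  qed
  have "\<exists>x. (\<forall>j<n. x j \<in> {0..R}) \<and> (\<forall>i<n. \<bar>L (U x) (a i) - x i\<bar> \<le> 2 * (e / 4))"
  proof (rule approximate_fixed_point_in_cube [OF \<open>0 < R\<close> _ \<open>0 < \<delta>\<close>])
    show "0 < e / 4" using \<open>0 < e\<close> by simp
    show "L (U x) (a i) \<in> {0..R}" if "\<And>j. j < n \<Longrightarrow> x j \<in> {0..R}" "i < n" for x i
      using into [OF U [OF that(1)]] a [OF that(2)] by (auto simp: continuous_band_def)
    show "\<bar>L (U x) (a i) - L (U y) (a i)\<bar> \<le> e / 4"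
      if "\<And>j. j < n \<Longrightarrow> x j \<in> {0..R}" "\<And>j. j < n \<Longrightarrow> y j \<in> {0..R}"
        "\<And>j. j < n \<Longrightarrow> \<bar>x j - y j\<bar> \<le> \<delta>" "i < n" for x y i
    proof -
      have close: "\<bar>U x t - U y t\<bar> \<le> \<delta>" if "t \<in> K" for t
        using average [OF that, of "\<lambda>j. x j - y j" \<delta>] \<open>\<And>j. j < n \<Longrightarrow> \<bar>x j - y j\<bar> \<le> \<delta>\<close>
        by (simp add: U_def left_diff_distrib sum_subtractf)
      have "\<forall>t\<in>K. \<bar>L (U x) t - L (U y) t\<bar> \<le> e / 4"
        using bspec [OF bspec [OF \<delta> U [OF that(1)]] U [OF that(2)]] close by simp
      then show ?thesis
        using a [OF \<open>i < n\<close>] by blast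
    qed
  qed
  then obtain x where x: "\<And>j. j < n \<Longrightarrow> x j \<in> {0..R}" "\<And>i. i < n \<Longrightarrow> \<bar>L (U x) (a i) - x i\<bar> \<le> e / 2"
    by auto
  have Ux: "U x \<in> continuous_band K R"
    by (rule U) (rule x(1))
  have "\<bar>L (U x) t - U x t\<bar> \<le> e" if "t \<in> K" for t
  proof -
    have "L (U x) t - U x t = (\<Sum>i<n. (L (U x) t - x i) * \<phi> i t)"
      using \<phi>_sum [OF that] by (simp add: U_def left_diff_distrib sum_subtractf flip: sum_distrib_left)
    moreover have "\<bar>\<Sum>i<n. (L (U x) t - x i) * \<phi> i t\<bar> \<le> e"
    proof (rule average [OF that])
      fix i assume i: "i < n" "\<phi> i t \<noteq> 0"
      then have "\<bar>L (U x) (a i) - L (U x) t\<bar> < e / 2"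
        using \<eta> Ux a [of i] \<phi>_supp [of i t] that by blast
      then show "\<bar>L (U x) t - x i\<bar> \<le> e"
        using x(2) [OF i(1)] by linarith
    qed
    ultimately show ?thesis by simp
  qed
  then show ?thesis
    using Ux by blast
qed

text \<open>
  The images of ever better approximate fixed points have a uniformly convergent subsequence by the
  theorem of Arzela and Ascoli; the approximate fixed points have the same limit, which is fixed.
\<close>

theorem Schauder_fixed_point_continuous_band:
  fixes K :: "'a::euclidean_space set" and L :: "('a \<Rightarrow> real) \<Rightarrow> 'a \<Rightarrow> real"
  assumes "compact K" "0 < R"
    and into: "\<And>u. u \<in> continuous_band K R \<Longrightarrow> L u \<in> continuous_band K R"
    and equicont: "\<And>e. 0 < e \<Longrightarrow> \<exists>d>0. \<forall>u\<in>continuous_band K R. \<forall>s\<in>K. \<forall>t\<in>K. dist s t < d \<longrightarrow> \<bar>L u s - L u t\<bar> < e"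
    and cont: "\<And>e. 0 < e \<Longrightarrow> \<exists>d>0. \<forall>u\<in>continuous_band K R. \<forall>w\<in>continuous_band K R.
            (\<forall>t\<in>K. \<bar>u t - w t\<bar> \<le> d) \<longrightarrow> (\<forall>t\<in>K. \<bar>L u t - L w t\<bar> \<le> e)"
  shows "\<exists>u\<in>continuous_band K R. \<forall>t\<in>K. L u t = u t"
proof -
  have "\<exists>u\<in>continuous_band K R. \<forall>t\<in>K. \<bar>L u t - u t\<bar> \<le> inverse (real (Suc n))" for n
    using assms by (intro Schauder_approximate_fixed_point) auto
  then obtain u where u: "\<And>n. u n \<in> continuous_band K R"
    and approx: "\<And>n t. t \<in> K \<Longrightarrow> \<bar>L (u n) t - u n t\<bar> \<le> inverse (real (Suc n))"
    by metis
  obtain g and k :: "nat \<Rightarrow> nat" where g: "continuous_on K g" and "strict_mono k"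
    and lim: "\<And>e. 0 < e \<Longrightarrow> \<exists>N. \<forall>n x. n \<ge> N \<and> x \<in> K \<longrightarrow> norm (L (u (k n)) x - g x) < e"
  proof (rule Arzela_Ascoli [OF \<open>compact K\<close>, of "\<lambda>n. L (u n)" R])
    show "norm (L (u n) t) \<le> R" if "t \<in> K" for n t
      using into [OF u, of n] that by (auto simp: continuous_band_def)
    show "\<exists>d>0. \<forall>n y. y \<in> K \<and> norm (x - y) < d \<longrightarrow> norm (L (u n) x - L (u n) y) < e"
      if x: "x \<in> K" "0 < e" for x e
    proof -
      obtain d where "d > 0" "\<forall>u\<in>continuous_band K R. \<forall>s\<in>K. \<forall>t\<in>K. dist s t < d \<longrightarrow> \<bar>L u s - L u t\<bar> < e"
        using equicont [OF x(2)] by blast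
      then show ?thesis
        using u x(1) by (intro exI [of _ d]) (auto simp: dist_norm)
    qed
  qed auto
  have close: "\<exists>n. \<forall>t\<in>K. \<bar>L (u n) t - g t\<bar> \<le> e \<and> \<bar>u n t - g t\<bar> \<le> 2 * e" if "0 < e" for e
  proof -
    obtain N where N: "\<forall>n x. n \<ge> N \<and> x \<in> K \<longrightarrow> norm (L (u (k n)) x - g x) < e"
      using lim [OF \<open>0 < e\<close>] by blast
    obtain M where M: "inverse (real (Suc M)) < e"
      using reals_Archimedean [OF \<open>0 < e\<close>] by blast
    define n where "n = k (max M N)"
    have "M \<le> n"
      using seq_suble [OF \<open>strict_mono k\<close>, of "max M N"] by (simp add: n_def)
    then have "inverse (real (Suc n)) \<le> inverse (real (Suc M))"
      by (intro le_imp_inverse_le) auto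
    then have "\<bar>L (u n) t - u n t\<bar> \<le> e" if "t \<in> K" for t
      using approx [OF that, of n] M by linarith
    moreover have "\<bar>L (u n) t - g t\<bar> \<le> e" if "t \<in> K" for t
      using N that by (force simp: n_def intro: less_imp_le)
    ultimately show ?thesis
      by (intro exI [of _ n]) fastforce
  qed
  have "g t \<in> {0..R}" if "t \<in> K" for t
  proof -
    have "- e \<le> g t \<and> g t \<le> R + e" if "0 < e" for e
    proof -
      obtain n where "\<forall>t\<in>K. \<bar>L (u n) t - g t\<bar> \<le> e"
        using close [OF \<open>0 < e\<close>] by blast
      then show ?thesis
        using into [OF u, of n] \<open>t \<in> K\<close> by (force simp: continuous_band_def)
    qed
    then have "0 \<le> g t + e" "g t \<le> R + e" if "0 < e" for e
      using that by force+
    then have "0 \<le> g t" "g t \<le> R"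
      by (blast intro: field_le_epsilon)+
    then show ?thesis by simp
  qed
  then have gband: "g \<in> continuous_band K R"
    using g by (simp add: continuous_band_def)
  have "L g t = g t" if "t \<in> K" for t
  proof -
    have "\<bar>L g t - g t\<bar> \<le> e" if "0 < e" for e
    proof -
      obtain d where "0 < d" and d: "\<forall>u\<in>continuous_band K R. \<forall>w\<in>continuous_band K R.
            (\<forall>t\<in>K. \<bar>u t - w t\<bar> \<le> d) \<longrightarrow> (\<forall>t\<in>K. \<bar>L u t - L w t\<bar> \<le> e / 2)"
        using cont [of "e / 2"] \<open>0 < e\<close> by auto
      obtain n where n: "\<forall>t\<in>K. \<bar>L (u n) t - g t\<bar> \<le> min (e / 2) (d / 2) \<and> \<bar>u n t - g t\<bar> \<le> 2 * min (e / 2) (d / 2)"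
        using close [of "min (e / 2) (d / 2)"] \<open>0 < d\<close> \<open>0 < e\<close> by auto
      then have "\<forall>t\<in>K. \<bar>u n t - g t\<bar> \<le> d" by fastforce
      then have "\<bar>L (u n) t - L g t\<bar> \<le> e / 2"
        using d u gband \<open>t \<in> K\<close> by blast
      moreover have "\<bar>L (u n) t - g t\<bar> \<le> e / 2"
        using n \<open>t \<in> K\<close> by fastforce
      ultimately show ?thesis by linarith
    qed
    then show ?thesis
      using field_le_epsilon [of "\<bar>L g t - g t\<bar>" 0] by force
  qed
  then show ?thesis using gband by blast
qed

section \<open>Fixed points of Hammerstein operators\<close>

text \<open>
  Replace \<open>u\<close> by its roundings down to multiples of \<open>1 / (n + 1)\<close>: these take countably many values, so
  the composition is measurable, and continuity in the second argument lets \<open>n\<close> tend to infinity.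
\<close>

lemma Caratheodory_superposition_measurable:
  fixes g :: "'a \<Rightarrow> real \<Rightarrow> real"
  assumes meas: "\<And>x. 0 \<le> x \<Longrightarrow> (\<lambda>s. g s x) \<in> borel_measurable M"
    and cont: "\<And>s. s \<in> space M \<Longrightarrow> continuous_on {0..} (g s)"
    and u: "u \<in> borel_measurable M" "\<And>s. s \<in> space M \<Longrightarrow> 0 \<le> u s"
  shows "(\<lambda>s. g s (u s)) \<in> borel_measurable M"
proof (rule borel_measurable_LIMSEQ_real)
  define q where "q = (\<lambda>n s. real (nat \<lfloor>real (Suc n) * u s\<rfloor>) / real (Suc n))"
  show "(\<lambda>s. g s (q n s)) \<in> borel_measurable M" for n
  proof -
    have "(\<lambda>s. nat \<lfloor>real (Suc n) * u s\<rfloor>) \<in> measurable M (count_space UNIV)"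
      using u(1) by measurable
    then show ?thesis
      unfolding q_def
      by (rule measurable_compose_countable [where f = "\<lambda>i s. g s (real i / real (Suc n))", rotated]) (simp add: meas)
  qed
  show "(\<lambda>n. g s (q n s)) \<longlonglongrightarrow> g s (u s)" if s: "s \<in> space M" for s
  proof (rule continuous_on_tendsto_compose [OF cont [OF s]])
    have "\<bar>q n s - u s\<bar> \<le> inverse (real (Suc n))" for n
    proof -
      have "q n s - u s = (real (nat \<lfloor>real (Suc n) * u s\<rfloor>) - real (Suc n) * u s) / real (Suc n)"
        by (simp add: q_def diff_divide_distrib)
      moreover have "\<bar>real (nat \<lfloor>real (Suc n) * u s\<rfloor>) - real (Suc n) * u s\<bar> \<le> 1"
        using u(2) [OF s] by (simp only: of_nat_nat zero_le_floor of_nat_0_le_iff mult_nonneg_nonneg) linarith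
      ultimately show ?thesis
        by (simp add: abs_divide divide_right_mono inverse_eq_divide del: of_nat_Suc)
    qed
    then have "(\<lambda>n. q n s - u s) \<longlonglongrightarrow> 0"
      by (intro Lim_null_comparison [OF _ LIMSEQ_inverse_real_of_nat] always_eventually) simp
    then show "(\<lambda>n. q n s) \<longlonglongrightarrow> u s"
      by (simp add: LIM_zero_iff)
  qed (use u(2) s in \<open>auto simp: q_def\<close>)
qed

text \<open>
  For each \<open>s\<close> the function \<open>g(s, \<cdot>)\<close> is uniformly continuous on \<open>[0, R]\<close>. Hence the integrand tends to \<open>0\<close>
  pointwise along any sequences of functions whose distances tend to \<open>0\<close>, and dominated convergence contradicts
  a failure of the claim.
\<close>

lemma Caratheodory_superposition_uniformly_continuous:
  fixes g :: "real \<Rightarrow> real \<Rightarrow> real"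
  assumes meas: "\<And>x. 0 \<le> x \<Longrightarrow> (\<lambda>s. g s x) \<in> borel_measurable (lebesgue_on {0..T})"
    and cont: "\<And>s. s \<in> {0..T} \<Longrightarrow> continuous_on {0..} (g s)"
    and bound: "\<And>s x. s \<in> {0..T} \<Longrightarrow> 0 \<le> x \<Longrightarrow> \<bar>g s x\<bar> \<le> b s" and "L1 T b" and "0 < e"
  shows "\<exists>d>0. \<forall>u\<in>continuous_band {0..T} R. \<forall>w\<in>continuous_band {0..T} R.
     (\<forall>t\<in>{0..T}. \<bar>u t - w t\<bar> \<le> d) \<longrightarrow> (LINT s|lebesgue_on {0..T}. \<bar>g s (u s) - g s (w s)\<bar>) \<le> e"
proof (rule ccontr)
  assume neg: "\<not> ?thesis"
  have "\<forall>n. \<exists>u w. u \<in> continuous_band {0..T} R \<and> w \<in> continuous_band {0..T} R \<and>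
      (\<forall>t\<in>{0..T}. \<bar>u t - w t\<bar> \<le> inverse (real (Suc n))) \<and>
      e < (LINT s|lebesgue_on {0..T}. \<bar>g s (u s) - g s (w s)\<bar>)" (is "\<forall>n. \<exists>u w. ?P n u w")
    using neg [simplified, rule_format, of "inverse (real (Suc n))" for n] by (force simp: not_le)
  then obtain u where "\<forall>n. \<exists>w. ?P n (u n) w"
    by (rule choice [THEN exE])
  then obtain w where uw: "\<forall>n. ?P n (u n) (w n)"
    by (rule choice [THEN exE])
  have band: "u n \<in> continuous_band {0..T} R" "w n \<in> continuous_band {0..T} R" for n
    using uw by auto
  have close: "\<bar>u n t - w n t\<bar> \<le> inverse (real (Suc n))" if "t \<in> {0..T}" for n t
    using uw that by blast
  have far: "e < (LINT s|lebesgue_on {0..T}. \<bar>g s (u n s) - g s (w n s)\<bar>)" for n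
    using uw by blast
  have sup_meas: "(\<lambda>s. g s (z s)) \<in> borel_measurable (lebesgue_on {0..T})"
    if z: "z \<in> continuous_band {0..T} R" for z
  proof (rule Caratheodory_superposition_measurable [OF meas])
    show "continuous_on {0..} (g s)" if "s \<in> space (lebesgue_on {0..T})" for s
      using that by (simp add: cont)
    show "z \<in> borel_measurable (lebesgue_on {0..T})"
      by (rule continuous_imp_measurable_on_sets_lebesgue) (use z in \<open>auto simp: continuous_band_def\<close>)
    show "0 \<le> z s" if "s \<in> space (lebesgue_on {0..T})" for s
      using that z by (simp add: continuous_band_def)
  qed
  have lim: "(\<lambda>n. \<bar>g s (u n s) - g s (w n s)\<bar>) \<longlonglongrightarrow> 0" if s: "s \<in> {0..T}" for s
  proof (rule LIMSEQ_I)
    fix r :: real assume "0 < r"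
    have "uniformly_continuous_on {0..R} (g s)"
      using cont [OF s] by (intro compact_uniformly_continuous) (auto intro: continuous_on_subset)
    then obtain d where "0 < d" and d: "\<forall>x\<in>{0..R}. \<forall>y\<in>{0..R}. dist y x < d \<longrightarrow> dist (g s y) (g s x) < r"
      using \<open>0 < r\<close> unfolding uniformly_continuous_on_def by blast
    obtain N where N: "inverse (real (Suc N)) < d"
      using reals_Archimedean [OF \<open>0 < d\<close>] by blast
    have "norm (\<bar>g s (u n s) - g s (w n s)\<bar> - 0) < r" if "N \<le> n" for n
    proof -
      have "inverse (real (Suc n)) \<le> inverse (real (Suc N))"
        using that by (intro le_imp_inverse_le) auto
      then have "dist (u n s) (w n s) < d"
        using close [OF s, of n] N unfolding dist_real_def by linarith
      then have "dist (g s (u n s)) (g s (w n s)) < r"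
        using d band [of n] s by (simp add: continuous_band_def)
      then show ?thesis by (simp add: dist_real_def)
    qed
    then show "\<exists>N. \<forall>n\<ge>N. norm (\<bar>g s (u n s) - g s (w n s)\<bar> - 0) < r" by blast
  qed
  have "(\<lambda>n. LINT s|lebesgue_on {0..T}. \<bar>g s (u n s) - g s (w n s)\<bar>) \<longlonglongrightarrow> (LINT s|lebesgue_on {0..T}. 0)"
  proof (rule integral_dominated_convergence [where w = "\<lambda>s. 2 * b s"])
    show "(\<lambda>s. \<bar>g s (u n s) - g s (w n s)\<bar>) \<in> borel_measurable (lebesgue_on {0..T})" for n
      using sup_meas [OF band(1)] sup_meas [OF band(2)] by (intro borel_measurable_abs borel_measurable_diff)
    show "AE s in lebesgue_on {0..T}. (\<lambda>n. \<bar>g s (u n s) - g s (w n s)\<bar>) \<longlonglongrightarrow> 0"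
      by (rule AE_I2) (simp add: lim)
    show "AE s in lebesgue_on {0..T}. norm \<bar>g s (u n s) - g s (w n s)\<bar> \<le> 2 * b s" for n
    proof (rule AE_I2)
      fix s assume "s \<in> space (lebesgue_on {0..T})"
      then have "\<bar>g s (u n s)\<bar> \<le> b s" "\<bar>g s (w n s)\<bar> \<le> b s"
        using band [of n] by (auto intro!: bound simp: continuous_band_def)
      then show "norm \<bar>g s (u n s) - g s (w n s)\<bar> \<le> 2 * b s"
        using abs_triangle_ineq4 [of "g s (u n s)" "g s (w n s)"] by simp
    qed
    show "integrable (lebesgue_on {0..T}) (\<lambda>s. 2 * b s)"
      using L1_cmult [OF \<open>L1 T b\<close>, of 2] unfolding L1_def .
  qed simp
  then have "(\<lambda>n. LINT s|lebesgue_on {0..T}. \<bar>g s (u n s) - g s (w n s)\<bar>) \<longlonglongrightarrow> 0" by simp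
  then have "e \<le> 0"
    by (rule LIMSEQ_le_const) (use far in \<open>auto intro: less_imp_le\<close>)
  then show False using \<open>0 < e\<close> by simp
qed

lemma abs_integral_kernel_le:
  assumes "L1 T (\<lambda>s. k s * h s)" "L1 T b" "\<And>s. s \<in> {0..T} \<Longrightarrow> \<bar>k s\<bar> \<le> C" "\<And>s. s \<in> {0..T} \<Longrightarrow> \<bar>h s\<bar> \<le> b s"
  shows "\<bar>LINT s|lebesgue_on {0..T}. k s * h s\<bar> \<le> C * (LINT s|lebesgue_on {0..T}. b s)"
proof -
  have "\<bar>LINT s|lebesgue_on {0..T}. k s * h s\<bar> \<le> (LINT s|lebesgue_on {0..T}. \<bar>k s * h s\<bar>)"
    by (rule integral_abs_bound)
  also have "\<dots> \<le> (LINT s|lebesgue_on {0..T}. C * b s)"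
  proof (rule integral_mono)
    show "integrable (lebesgue_on {0..T}) (\<lambda>s. \<bar>k s * h s\<bar>)"
      using assms(1) by (simp add: L1_def)
    show "integrable (lebesgue_on {0..T}) (\<lambda>s. C * b s)"
      using L1_cmult [OF assms(2)] by (simp add: L1_def)
    show "\<bar>k s * h s\<bar> \<le> C * b s" if "s \<in> space (lebesgue_on {0..T})" for s
      unfolding abs_mult using assms(3) [of s] assms(4) [of s] that by (intro mult_mono) auto
  qed
  also have "\<dots> = C * (LINT s|lebesgue_on {0..T}. b s)"
    by simp
  finally show ?thesis .
qed

text \<open>
  Schauder's theorem for \<open>L u = G (g(\<cdot>, u))\<close>. The bounds on \<open>g\<close> make \<open>L u\<close> nonnegative, bounded by
  \<open>max \<bar>G\<bar> \<integral> M v\<close>, and equicontinuous because \<open>G\<close> is uniformly continuous.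
\<close>

lemma Hammerstein_fixed_point:
  assumes "0 < T" and G: "continuous_on ({0..T} \<times> {0..T}) (\<lambda>(t, s). G t s)"
    and v: "continuous_on {0..T} v" "\<And>s. s \<in> {0..T} \<Longrightarrow> 0 < v s"
    and "0 < m" and ratio: "ereal (M / m) \<le> Green_ratio T G v"
    and meas: "\<And>x. 0 \<le> x \<Longrightarrow> (\<lambda>s. g s x) \<in> borel_measurable (lebesgue_on {0..T})"
    and cont: "\<And>s. s \<in> {0..T} \<Longrightarrow> continuous_on {0..} (g s)"
    and bounds: "\<And>s x. s \<in> {0..T} \<Longrightarrow> 0 \<le> x \<Longrightarrow> m * v s \<le> g s x \<and> g s x \<le> M * v s"
  shows "\<exists>u. L1 T (\<lambda>s. g s (u s)) \<and> (\<forall>t\<in>{0..T}. 0 \<le> u t \<and> u t = Green_op T G (\<lambda>s. g s (u s)) t)"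
proof -
  define b where "b = (\<lambda>s. M * v s)"
  have "L1 T b"
    unfolding b_def by (rule L1_cmult [OF L1_continuous [OF v(1)]])
  have g_bound: "\<bar>g s x\<bar> \<le> b s" if "s \<in> {0..T}" "0 \<le> x" for s x
  proof -
    have "0 < m * v s" using v(2) [OF that(1)] \<open>0 < m\<close> by simp
    then show ?thesis using bounds [OF that] by (simp add: b_def)
  qed
  define V where "V = (LINT s|lebesgue_on {0..T}. b s)"
  have "0 \<le> b s" if "s \<in> {0..T}" for s
    using g_bound [OF that, of 0] by linarith
  then have "0 \<le> V"
    unfolding V_def by (intro integral_nonneg_AE AE_I2) simp
  obtain B where "0 < B" and B: "\<And>t s. t \<in> {0..T} \<Longrightarrow> s \<in> {0..T} \<Longrightarrow> \<bar>G t s\<bar> \<le> B"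
  proof -
    have "bounded ((\<lambda>(t, s). G t s) ` ({0..T} \<times> {0..T}))"
      by (intro compact_imp_bounded compact_continuous_image [OF G] compact_Times compact_Icc)
    then obtain B where "0 < B" "\<forall>x\<in>(\<lambda>(t, s). G t s) ` ({0..T} \<times> {0..T}). norm x \<le> B"
      unfolding bounded_pos by blast
    then show thesis by (intro that [of B]) auto
  qed
  \<comment> \<open>The summand \<open>1\<close> only ensures that \<open>R\<close> is positive.\<close>
  define R where "R = B * V + 1"
  have "0 < R"
    using \<open>0 < B\<close> \<open>0 \<le> V\<close> by (simp add: R_def add_nonneg_pos)
  let ?D = "continuous_band {0..T} R"
  define L where "L = (\<lambda>u. Green_op T G (\<lambda>s. g s (u s)))"
  have band: "0 \<le> u s" if "u \<in> ?D" "s \<in> {0..T}" for u s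
    using that by (simp add: continuous_band_def)
  have L1g: "L1 T (\<lambda>s. g s (u s))" if u: "u \<in> ?D" for u
  proof -
    have "(\<lambda>s. g s (u s)) \<in> borel_measurable (lebesgue_on {0..T})"
    proof (rule Caratheodory_superposition_measurable [OF meas])
      show "u \<in> borel_measurable (lebesgue_on {0..T})"
        by (rule continuous_imp_measurable_on_sets_lebesgue) (use u in \<open>auto simp: continuous_band_def\<close>)
    qed (use cont band [OF u] in auto)
    moreover have "AE s in lebesgue_on {0..T}. norm (g s (u s)) \<le> norm (b s)"
    proof (rule AE_I2)
      fix s assume "s \<in> space (lebesgue_on {0..T})"
      then show "norm (g s (u s)) \<le> norm (b s)"
        using g_bound [of s "u s"] band [OF u, of s] by simp
    qed
    ultimately show ?thesis
      using \<open>L1 T b\<close> unfolding L1_def using Bochner_Integration.integrable_bound by blast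
  qed
  have row: "continuous_on {0..T} (G t)" if "t \<in> {0..T}" for t
    by (rule continuous_kernel_row [OF G that])
  have L1_row: "L1 T (\<lambda>s. G t s * h s)" if "t \<in> {0..T}" "L1 T h" for t h
    by (rule L1_mult_continuous [OF row [OF that(1)] that(2)])
  have equicont: "\<exists>d>0. \<forall>u\<in>?D. \<forall>s\<in>{0..T}. \<forall>t\<in>{0..T}. dist s t < d \<longrightarrow> \<bar>L u s - L u t\<bar> < e" if "0 < e" for e
  proof -
    define e' where "e' = e / (V + 1)"
    have "0 < e'" and e': "e' * V < e"
      using \<open>0 < e\<close> \<open>0 \<le> V\<close> by (auto simp: e'_def field_simps)
    have "uniformly_continuous_on ({0..T} \<times> {0..T}) (\<lambda>(t, s). G t s)"
      by (intro compact_uniformly_continuous G compact_Times compact_Icc)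
    then obtain d where "0 < d" and d: "\<forall>x\<in>{0..T} \<times> {0..T}. \<forall>y\<in>{0..T} \<times> {0..T}. dist y x < d \<longrightarrow>
        dist (case y of (t, s) \<Rightarrow> G t s) (case x of (t, s) \<Rightarrow> G t s) < e'"
      using \<open>0 < e'\<close> unfolding uniformly_continuous_on_def by blast
    have "\<bar>L u s - L u t\<bar> < e" if u: "u \<in> ?D" and st: "s \<in> {0..T}" "t \<in> {0..T}" "dist s t < d" for u s t
    proof -
      have near: "\<bar>G s r - G t r\<bar> \<le> e'" if "r \<in> {0..T}" for r
        using d [THEN bspec, of "(t, r)", THEN bspec, of "(s, r)"] that st
        by (simp add: dist_Pair_Pair dist_real_def)
      have int: "L1 T (\<lambda>r. (G s r - G t r) * g r (u r))"
        by (intro L1_mult_continuous continuous_on_diff row st L1g u)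
      have "L u s - L u t = (LINT r|lebesgue_on {0..T}. (G s r - G t r) * g r (u r))"
        using L1_row [OF st(1) L1g [OF u]] L1_row [OF st(2) L1g [OF u]]
        by (simp add: L_def Green_op_def L1_def left_diff_distrib)
      then have "\<bar>L u s - L u t\<bar> \<le> e' * V"
        using abs_integral_kernel_le [OF int \<open>L1 T b\<close> near] g_bound band [OF u] by (simp add: V_def)
      then show ?thesis using e' by simp
    qed
    then show ?thesis using \<open>0 < d\<close> by blast
  qed
  have "\<exists>u\<in>?D. \<forall>t\<in>{0..T}. L u t = u t"
  proof (rule Schauder_fixed_point_continuous_band [OF compact_Icc \<open>0 < R\<close> _ equicont])
    show "L u \<in> ?D" if u: "u \<in> ?D" for u
    proof -
      have "continuous_on {0..T} (L u)"
        unfolding continuous_on_iff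
      proof (intro ballI allI impI)
        fix t e :: real assume t: "t \<in> {0..T}" and "0 < e"
        then obtain d where "0 < d" "\<forall>u\<in>?D. \<forall>s\<in>{0..T}. \<forall>t\<in>{0..T}. dist s t < d \<longrightarrow> \<bar>L u s - L u t\<bar> < e"
          using equicont by blast
        then show "\<exists>d>0. \<forall>s\<in>{0..T}. dist s t < d \<longrightarrow> dist (L u s) (L u t) < e"
          using u t unfolding dist_real_def by blast
      qed
      moreover have "L u t \<in> {0..R}" if t: "t \<in> {0..T}" for t
      proof -
        have "0 \<le> L u t"
          unfolding L_def
          by (rule Green_op_nonneg [OF G v ratio \<open>0 < m\<close> L1g [OF u] _ t]) (use bounds band [OF u] in auto)
        moreover have "\<bar>L u t\<bar> \<le> B * V"
          unfolding L_def Green_op_def V_def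
          by (rule abs_integral_kernel_le [OF L1_row [OF t L1g [OF u]] \<open>L1 T b\<close>])
            (use B t g_bound band [OF u] in auto)
        ultimately show ?thesis by (simp add: R_def)
      qed
      ultimately show ?thesis by (simp add: continuous_band_def)
    qed
    show "\<exists>d>0. \<forall>u\<in>?D. \<forall>w\<in>?D. (\<forall>t\<in>{0..T}. \<bar>u t - w t\<bar> \<le> d) \<longrightarrow> (\<forall>t\<in>{0..T}. \<bar>L u t - L w t\<bar> \<le> e)"
      if "0 < e" for e
    proof -
      have "0 < e / B" using \<open>0 < e\<close> \<open>0 < B\<close> by simp
      from Caratheodory_superposition_uniformly_continuous [OF meas cont g_bound \<open>L1 T b\<close> this, of R]
      obtain d where "0 < d" and d: "\<forall>u\<in>?D. \<forall>w\<in>?D. (\<forall>t\<in>{0..T}. \<bar>u t - w t\<bar> \<le> d) \<longrightarrow>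
          (LINT s|lebesgue_on {0..T}. \<bar>g s (u s) - g s (w s)\<bar>) \<le> e / B"
        by blast
      have "\<bar>L u t - L w t\<bar> \<le> e"
        if uw: "u \<in> ?D" "w \<in> ?D" "\<forall>t\<in>{0..T}. \<bar>u t - w t\<bar> \<le> d" and t: "t \<in> {0..T}" for u w t
      proof -
        have diff: "L1 T (\<lambda>s. g s (u s) - g s (w s))"
          by (intro L1_diff L1g uw)
        then have "L1 T (\<lambda>s. \<bar>g s (u s) - g s (w s)\<bar>)"
          by (simp add: L1_def)
        moreover have "L u t - L w t = (LINT s|lebesgue_on {0..T}. G t s * (g s (u s) - g s (w s)))"
          using L1_row [OF t L1g [OF uw(1)]] L1_row [OF t L1g [OF uw(2)]]
          by (simp add: L_def Green_op_def L1_def right_diff_distrib)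
        ultimately have "\<bar>L u t - L w t\<bar> \<le> B * (LINT s|lebesgue_on {0..T}. \<bar>g s (u s) - g s (w s)\<bar>)"
          using abs_integral_kernel_le [OF L1_row [OF t diff], of "\<lambda>s. \<bar>g s (u s) - g s (w s)\<bar>" B] B [OF t] by simp
        also have "\<dots> \<le> B * (e / B)"
          using d uw \<open>0 < B\<close> by (intro mult_left_mono) auto
        finally show ?thesis using \<open>0 < B\<close> by simp
      qed
      then show ?thesis using \<open>0 < d\<close> by blast
    qed
  qed
  then obtain u where u: "u \<in> ?D" "\<forall>t\<in>{0..T}. L u t = u t"
    by blast
  have "0 \<le> u t \<and> u t = Green_op T G (\<lambda>s. g s (u s)) t" if "t \<in> {0..T}" for t
    using u(2) band [OF u(1)] that by (simp add: L_def)
  then show ?thesis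
    using L1g [OF u(1)] by blast
qed

section \<open>Existence of a positive solution in the cone\<close>

lemma periodic_solution_cong_AE:
  assumes "periodic_solution T q h u" "AE t in lebesgue_on {0..T}. h t = k t"
  shows "periodic_solution T q k u"
proof -
  obtain u' u'' where u: "W21 T u u' u''" "AE t in lebesgue_on {0..T}. u'' t + q t * u t = h t"
      "u 0 = u T" "u' 0 = u' T"
    using assms(1) by (auto simp: periodic_solution_def)
  moreover have "AE t in lebesgue_on {0..T}. u'' t + q t * u t = k t"
    using u(2) assms(2) by (rule eventually_elim2) simp
  ultimately show ?thesis
    unfolding periodic_solution_def by blast
qed

theorem theorem3p4:
  fixes T :: real and \<alpha> :: ennreal and a :: "real \<Rightarrow> real"
    and lamP lamA :: real and G :: "real \<Rightarrow> real \<Rightarrow> real" and vP :: "real \<Rightarrow> real"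
    and f :: "real \<Rightarrow> real \<Rightarrow> real" and m M c d :: real
  assumes "0 < T" and "1 \<le> \<alpha>" and "Lp \<alpha> T a"
    and nonresonant: "\<And>u. periodic_solution T a (\<lambda>t. 0) u \<Longrightarrow> \<forall>t\<in>{0..T}. u t = 0"
    and lambda_P: "smallest (periodic_eigenvalue T a) lamP"
    and lambda_A: "smallest (antiperiodic_eigenvalue T a) lamA"
    and G_P: "periodic_Green T a G"
    and v_P: "positive_eigenfunction T a lamP vP"
    and lambda_A_neg: "lamA < 0"
    and f_nonneg: "\<And>t x. t \<in> {0..T} \<Longrightarrow> 0 \<le> x \<Longrightarrow> 0 \<le> f t x"
    and f_Caratheodory: "L1_Caratheodory T f"
    and "0 < m" and "0 < M"
    and f_bounds: "\<And>t x. t \<in> {0..T} \<Longrightarrow> 0 \<le> x \<Longrightarrow> m * vP t \<le> f t x \<and> f t x \<le> M * vP t"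
    and ratio: "ereal (M / m) \<le> Green_ratio T G vP"
    and "0 \<le> c" and "c < d" and "d \<le> T"
    and G_nonneg: "\<And>s. s \<in> {0..T} \<Longrightarrow> 0 \<le> (LINT t|lebesgue_on {c..d}. G t s)"
    and G_pos: "\<And>s. s \<in> {c..d} \<Longrightarrow> 0 < (LINT t|lebesgue_on {c..d}. G t s)"
  shows "\<exists>u \<in> pos_cone T (cone_const T G c d).
           periodic_solution T a (\<lambda>t. f t (u t)) u \<and> (\<exists>t\<in>{0..T}. u t \<noteq> 0)"
proof -
  have v_sol: "periodic_solution T a (\<lambda>t. - lamP * vP t) vP" and v_pos: "\<And>t. t \<in> {0..T} \<Longrightarrow> 0 < vP t"
    using v_P by (auto simp: positive_eigenfunction_def)
  have v_cont: "continuous_on {0..T} vP"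
    by (rule periodic_solution_continuous [OF v_sol])
  have G_cont: "continuous_on ({0..T} \<times> {0..T}) (\<lambda>(t, s). G t s)"
    by (rule periodic_Green_continuous [OF G_P])
  have L1v: "L1 T vP"
    by (rule L1_continuous [OF v_cont])

  \<comment> \<open>The sign of the eigenvalue: the positivity lemma applies to \<open>h = m v\<close> because \<open>m \<le> M\<close>.\<close>
  have "m * vP 0 \<le> M * vP 0"
    using f_bounds [of 0 0] \<open>0 < T\<close> by simp
  then have "m \<le> M"
    using v_pos [of 0] \<open>0 < T\<close> by (simp add: mult_le_cancel_right)
  have "0 \<le> Green_op T G (\<lambda>s. m * vP s - 0 * vP s) 0"
    using \<open>0 < T\<close> \<open>m \<le> M\<close> v_pos
    by (intro Green_op_nonneg [OF G_cont v_cont v_pos ratio \<open>0 < m\<close>] L1_diff L1_cmult L1v)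
      (auto intro: mult_right_mono less_imp_le)
  then have "0 \<le> m * Green_op T G vP 0"
    using Green_op_linear [OF G_P L1v L1v, of 0 m 0] \<open>0 < T\<close> by simp
  then have "0 \<le> Green_op T G vP 0"
    using \<open>0 < m\<close> by (simp add: zero_le_mult_iff)
  then have "lamP < 0" and Gv_pos: "0 < Green_op T G vP 0"
    using eigenvalue_neg [OF _ G_P v_P] \<open>0 < T\<close> by simp_all

  have "AE s in lebesgue_on {0..T}. continuous_on {0..} (f s)"
    using f_Caratheodory by (simp add: L1_Caratheodory_def)
  then obtain N where "negligible N" and N: "\<forall>s\<in>{0..T} - N. continuous_on {0..} (f s)"
    using AE_lebesgue_on_imp_negligible by blast
  \<comment> \<open>On the null set where \<open>f(s, \<cdot>)\<close> may be discontinuous, a value is chosen that keeps the bounds of \<open>f\<close>.\<close>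
  define g where "g = (\<lambda>s x. if s \<in> N then m * vP s else f s x)"
  have "\<exists>u. L1 T (\<lambda>s. g s (u s)) \<and> (\<forall>t\<in>{0..T}. 0 \<le> u t \<and> u t = Green_op T G (\<lambda>s. g s (u s)) t)"
  proof (rule Hammerstein_fixed_point [OF \<open>0 < T\<close> G_cont v_cont v_pos \<open>0 < m\<close> ratio])
    show "(\<lambda>s. g s x) \<in> borel_measurable (lebesgue_on {0..T})" if "0 \<le> x" for x
      unfolding g_def
    proof (rule measurable_If)
      show "(\<lambda>s. m * vP s) \<in> borel_measurable (lebesgue_on {0..T})"
        by (intro continuous_imp_measurable_on_sets_lebesgue continuous_intros v_cont) simp
      show "(\<lambda>s. f s x) \<in> borel_measurable (lebesgue_on {0..T})"
        using f_Caratheodory that by (simp add: L1_Caratheodory_def)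
      have "N \<inter> {0..T} \<in> sets (lebesgue_on {0..T})"
        using negligible_imp_sets [OF \<open>negligible N\<close>] by (auto simp: sets_restrict_space)
      then show "{s \<in> space (lebesgue_on {0..T}). s \<in> N} \<in> sets (lebesgue_on {0..T})"
        by (simp add: Int_def conj_commute)
    qed
    show "continuous_on {0..} (g s)" if "s \<in> {0..T}" for s
      using N that by (cases "s \<in> N") (auto simp: g_def)
    show "m * vP s \<le> g s x \<and> g s x \<le> M * vP s" if "s \<in> {0..T}" "0 \<le> x" for s x
      using f_bounds [OF that] \<open>m \<le> M\<close> v_pos [OF that(1)] by (auto simp: g_def mult_right_mono)
  qed
  then obtain u where L1g: "L1 T (\<lambda>s. g s (u s))" and u_nonneg: "\<And>t. t \<in> {0..T} \<Longrightarrow> 0 \<le> u t"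
    and u_eq: "\<And>t. t \<in> {0..T} \<Longrightarrow> u t = Green_op T G (\<lambda>s. g s (u s)) t"
    by blast
  define h where "h = (\<lambda>s. g s (u s))"
  have L1h: "L1 T h" using L1g by (simp add: h_def)
  have u_eq: "u t = Green_op T G h t" if "t \<in> {0..T}" for t
    using u_eq [OF that] by (simp add: h_def)
  have h_ge: "m * vP s \<le> h s" if "s \<in> {0..T}" for s
    using f_bounds [OF that u_nonneg [OF that]] by (simp add: h_def g_def)
  have sol: "periodic_solution T a h u"
    using G_P L1h u_eq unfolding periodic_Green_def Green_op_def by blast
  have u_cont: "continuous_on {0..T} u"
    by (rule periodic_solution_continuous [OF sol])

  \<comment> \<open>The change of \<open>f\<close> on a null set does not affect the equation.\<close>
  have "AE t in lebesgue. t \<notin> N"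
    using \<open>negligible N\<close> by (intro AE_not_in) (simp add: negligible_iff_null_sets)
  then have "AE t in lebesgue_on {0..T}. t \<notin> N"
    by (auto simp: AE_restrict_space_iff elim: eventually_mono)
  then have "AE t in lebesgue_on {0..T}. h t = f t (u t)"
    by (rule eventually_mono) (simp add: h_def g_def)
  then have solution: "periodic_solution T a (\<lambda>t. f t (u t)) u"
    by (rule periodic_solution_cong_AE [OF sol])

  \<comment> \<open>By Green's identity with the eigenfunction, \<open>\<integral> v h = - \<lambda>\<^sub>P \<integral> u v\<close>, which would vanish
    although \<open>v h \<ge> m v\<^sup>2 > 0\<close>.\<close>
  have nonzero: "\<exists>t\<in>{0..T}. u t \<noteq> 0"
  proof (rule ccontr)
    assume "\<not> ?thesis"
    then have zero: "u t = 0" if "t \<in> {0..T}" for t using that by blast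
    obtain t0 where t0: "t0 \<in> {0..T}" "\<And>t. t \<in> {0..T} \<Longrightarrow> vP t0 \<le> vP t"
      using continuous_attains_inf [OF compact_Icc _ v_cont] \<open>0 < T\<close> by auto
    have L1c: "L1 T (\<lambda>_. m * vP t0 * vP t0)"
      by (rule L1_continuous) (rule continuous_on_const)
    have "0 < m * vP t0 * vP t0 * T"
      using v_pos [OF t0(1)] \<open>0 < m\<close> \<open>0 < T\<close> by simp
    also have "\<dots> = (LINT s|lebesgue_on {0..T}. m * vP t0 * vP t0)"
      using \<open>0 < T\<close> by (simp add: measure_restrict_space)
    also have "\<dots> \<le> (LINT s|lebesgue_on {0..T}. vP s * h s)"
    proof (rule integral_mono)
      fix s assume "s \<in> space (lebesgue_on {0..T})"
      then have s: "s \<in> {0..T}" by simp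
      have "vP t0 * (m * vP t0) \<le> vP s * (m * vP s)"
        using t0(2) [OF s] v_pos [OF t0(1)] \<open>0 < m\<close> by (intro mult_mono) auto
      also have "\<dots> \<le> vP s * h s"
        using h_ge [OF s] v_pos [OF s] by (intro mult_left_mono) auto
      finally show "m * vP t0 * vP t0 \<le> vP s * h s"
        by (simp add: mult_ac)
    qed (use L1c L1_mult_continuous [OF v_cont L1h] in \<open>simp_all add: L1_def\<close>)
    also have "\<dots> = (LINT s|lebesgue_on {0..T}. u s * (- lamP * vP s))"
      using \<open>0 < T\<close> by (intro Green_identity [OF _ v_sol sol] L1_cmult L1v L1h) simp
    also have "\<dots> = (LINT s|lebesgue_on {0..T}. 0)"
      using zero by (intro Bochner_Integration.integral_cong refl) simp
    finally show False by simp
  qed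

  define S where "S = (SUP (t, s)\<in>{0..T} \<times> {0..T}. G t s)"
  define \<eta> where "\<eta> = (INF s\<in>{c..d}. LINT t|lebesgue_on {c..d}. G t s)"
  have G_le: "G t s \<le> S" if "t \<in> {0..T}" "s \<in> {0..T}" for t s
  proof -
    have "bdd_above ((\<lambda>(t, s). G t s) ` ({0..T} \<times> {0..T}))"
      by (intro bounded_imp_bdd_above compact_imp_bounded compact_continuous_image [OF G_cont] compact_Times compact_Icc)
    then show ?thesis
      using cSUP_upper [of "(t, s)" "{0..T} \<times> {0..T}" "\<lambda>(t, s). G t s"] that by (simp add: S_def)
  qed
  have "0 < S"
  proof (rule ccontr)
    assume "\<not> 0 < S"
    then have "0 \<le> - (G 0 s * vP s)" if "s \<in> {0..T}" for s
      using G_le [of 0 s] v_pos [OF that] that \<open>0 < T\<close> by (simp add: mult_nonpos_nonneg)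
    then have "0 \<le> (LINT s|lebesgue_on {0..T}. - (G 0 s * vP s))"
      by (intro integral_nonneg_AE AE_I2) simp
    then show False
      using Gv_pos by (simp add: Green_op_def)
  qed
  have "bdd_below ((\<lambda>s. LINT t|lebesgue_on {c..d}. G t s) ` {c..d})"
    using G_pos by (intro bdd_belowI [of _ 0]) (auto intro: less_imp_le)
  then have \<eta>_le: "\<eta> \<le> (LINT t|lebesgue_on {c..d}. G t s)" if "s \<in> {c..d}" for s
    unfolding \<eta>_def using that by (intro cINF_lower)
  have "0 \<le> \<eta>"
    unfolding \<eta>_def using G_pos \<open>c < d\<close> by (intro cINF_greatest) (auto intro: less_imp_le)
  have arc: "s \<in> {0..T}" if "s \<in> {c..d}" for s
    using that \<open>0 \<le> c\<close> \<open>d \<le> T\<close> by auto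
  note w_eq = integrated_kernel_eq_Green_op [OF \<open>0 < T\<close> G_P \<open>0 \<le> c\<close> \<open>d \<le> T\<close>]
  have w_pos: "0 < Green_op T G (indicat_real {c..d}) s" if "s \<in> {0..T}" for s
  proof (rule integrated_kernel_pos [OF \<open>0 < T\<close> \<open>0 \<le> c\<close> less_imp_le [OF \<open>c < d\<close>] \<open>d \<le> T\<close> G_P v_P less_imp_le [OF \<open>lamP < 0\<close>] _ _ that])
    show "0 \<le> Green_op T G (indicat_real {c..d}) s" if "s \<in> {0..T}" for s
      using G_nonneg [OF that] w_eq [OF that] by simp
    show "0 < Green_op T G (indicat_real {c..d}) s" if "s \<in> {c..d}" for s
      using G_pos [OF that] w_eq [OF arc [OF that]] by simp
  qed
  have cone: "\<eta> * u t \<le> S * (LINT s|lebesgue_on {0..T}. u s)" if t: "t \<in> {0..T}" for t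
  proof -
    have int: "L1 T (\<lambda>s. u s * indicat_real {c..d} s)"
      by (rule L1_mult_continuous [OF u_cont L1_indicator])
    have "\<eta> * Green_op T G h t \<le> S * (LINT s|lebesgue_on {c..d}. Green_op T G h s)"
    proof (rule Green_op_le_integral [OF \<open>0 < T\<close> \<open>0 \<le> c\<close> less_imp_le [OF \<open>c < d\<close>] \<open>d \<le> T\<close> G_P w_pos \<open>0 \<le> \<eta>\<close> _ less_imp_le [OF \<open>0 < S\<close>] G_le L1h _ t])
      show "\<eta> \<le> Green_op T G (indicat_real {c..d}) s" if "s \<in> {c..d}" for s
        using \<eta>_le [OF that] w_eq [OF arc [OF that]] by simp
      show "0 \<le> h s" if "s \<in> {0..T}" for s
        using h_ge [OF that] v_pos [OF that] \<open>0 < m\<close> mult_pos_pos [of m "vP s"] by linarith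
    qed
    also have "(LINT s|lebesgue_on {c..d}. Green_op T G h s) = (LINT s|lebesgue_on {c..d}. u s)"
      using u_eq arc by (intro Bochner_Integration.integral_cong refl) simp
    also have "\<dots> = (LINT s|lebesgue_on {0..T}. u s * indicat_real {c..d} s)"
      by (rule integral_subinterval [OF \<open>0 \<le> c\<close> \<open>d \<le> T\<close>])
    also have "\<dots> \<le> (LINT s|lebesgue_on {0..T}. u s)"
      using int L1_continuous [OF u_cont] u_nonneg
      by (intro integral_mono) (auto simp: L1_def indicator_def)
    finally show ?thesis
      using u_eq [OF t] \<open>0 < S\<close> by simp
  qed
  have "cone_const T G c d * sup_norm T u \<le> (LINT s|lebesgue_on {0..T}. u s)"
  proof -
    obtain t0 where t0: "t0 \<in> {0..T}" "\<And>t. t \<in> {0..T} \<Longrightarrow> u t \<le> u t0"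
      using continuous_attains_sup [OF compact_Icc _ u_cont] \<open>0 < T\<close> by auto
    have "sup_norm T u = u t0"
      unfolding sup_norm_def using t0 u_nonneg
      by (intro cSup_eq_maximum) (auto intro!: image_eqI [of _ _ t0])
    then show ?thesis
      using cone [OF t0(1)] \<open>0 < S\<close> by (simp add: cone_const_def S_def [symmetric] \<eta>_def [symmetric] field_simps)
  qed
  then have "u \<in> pos_cone T (cone_const T G c d)"
    using u_cont u_nonneg by (simp add: pos_cone_def)
  then show ?thesis
    using solution nonzero by blast
qed

end
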